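(* Let $1\le p\le\infty$. Let $F:\mathbb{T}\to\mathbb{C}$ be such that $t\mapsto F(e^{it})$ is absolutely continuous on $[0,2\pi]$ (with $F(e^{i0})=F(e^{i2\pi})$), and suppose $\dot F\in L^p(0,2\pi)$, where $\dot F(e^{it})=\frac{d}{dt}F(e^{it})$. Suppose $w=P[F]$ is a quasiregular mapping of $\mathbb{D}$ with outer dilatation $K\ge1$. Then $w_z\in H^p$, $\overline{w_{\bar z}}\in H^p$, and $$\|w_z\|_p\le K\|\dot F\|_{L^p},\qquad \|\overline{w_{\bar z}}\|_p\le\frac{K-1}{2}\|\dot F\|_{L^p}.$$
   Context: $\mathbb{D}$ is the open unit disk and $\mathbb{T}$ the unit circle. For $F\in L^1(\mathbb{T})$, $P[F](re^{i\theta})=\int_0^{2\pi}P_r(t-\theta)F(e^{it})\,dt$ with $P_r(t-\theta)=\frac{1}{2\pi}\frac{1-r^2}{1-2r\cos(t-\theta)+r^2}$. $w_z=\frac12(w_x-iw_y)$, $w_{\bar z}=\frac12(w_x+iw_y)$; for harmonic $w$, both $w_z$ and $\overline{w_{\bar z}}$ are analytic in $\mathbb{D}$. A harmonic mapping $w$ of $\mathbb{D}$ is quasiregular if there is a constant $K\ge1$ with $(|w_z|+|w_{\bar z}|)^2\le K(|w_z|^2-|w_{\bar z}|^2)$ in $\mathbb{D}$; the smallest such $K$ is the outer dilatation. For $G$ on $[0,2\pi]$, $\|G\|_{L^p}=\left(\frac{1}{2\pi}\int_0^{2\pi}|G(e^{it})|^p\,dt\right)^{1/p}$ for $p<\infty$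 and $\|G\|_{L^\infty}=\operatorname{ess\,sup}|G|$. For analytic $f$ on $\mathbb{D}$, $M_p(r,f)=\left(\frac1{2\pi}\int_0^{2\pi}|f(re^{i\theta})|^p d\theta\right)^{1/p}$ ($0<p<\infty$), $M_\infty(r,f)=\max_\theta|f(re^{i\theta})|$; $f\in H^p$ if $M_p(r,f)$ is bounded in $r\in(0,1)$, and $\|f\|_p=\lim_{r\to1^-}M_p(r,f)$. *)

theory Defs
  imports "HOL-Analysis.Analysis" "HOL-Probability.Essential_Supremum"
begin

definition abs_continuous_on :: "real \<Rightarrow> real \<Rightarrow> (real \<Rightarrow> 'b::real_normed_vector) \<Rightarrow> bool" where
  "abs_continuous_on a b f \<longleftrightarrow>
     (\<forall>\<epsilon>>0. \<exists>\<delta>>0. \<forall>(n::nat) (u::nat \<Rightarrow> real) v.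
        (\<forall>k<n. a \<le> u k \<and> u k \<le> v k \<and> v k \<le> b) \<longrightarrow>
        (\<forall>i<n. \<forall>j<n. i \<noteq> j \<longrightarrow> v i \<le> u j \<or> v j \<le> u i) \<longrightarrow>
        (\<Sum>k<n. v k - u k) < \<delta> \<longrightarrow>
        (\<Sum>k<n. norm (f (v k) - f (u k))) < \<epsilon>)"

definition poisson_kernel :: "real \<Rightarrow> real \<Rightarrow> real" where
  "poisson_kernel r s = (1 / (2 * pi)) * ((1 - r\<^sup>2) / (1 - 2 * r * cos s + r\<^sup>2))"

definition poisson_integral :: "(complex \<Rightarrow> complex) \<Rightarrow> complex \<Rightarrow> complex" where
  "poisson_integral F z =
     integral {0..2*pi} (\<lambda>t. of_real (poisson_kernel (cmod z) (t - Arg z)) * F (cis t))"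

definition wirt_z :: "(complex \<Rightarrow> complex) \<Rightarrow> complex \<Rightarrow> complex" where
  "wirt_z w z = (frechet_derivative w (at z) 1 - \<i> * frechet_derivative w (at z) \<i>) / 2"

definition wirt_zbar :: "(complex \<Rightarrow> complex) \<Rightarrow> complex \<Rightarrow> complex" where
  "wirt_zbar w z = (frechet_derivative w (at z) 1 + \<i> * frechet_derivative w (at z) \<i>) / 2"

definition qr_bound :: "(complex \<Rightarrow> complex) \<Rightarrow> real \<Rightarrow> bool" where
  "qr_bound w K \<longleftrightarrow> K \<ge> 1 \<and> (\<forall>z\<in>ball 0 1.
      (cmod (wirt_z w z) + cmod (wirt_zbar w z))\<^sup>2 \<le> K * ((cmod (wirt_z w z))\<^sup>2 - (cmod (wirt_zbar w z))\<^sup>2))"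

definition harmonic_quasiregular :: "(complex \<Rightarrow> complex) \<Rightarrow> bool" where
  "harmonic_quasiregular w \<longleftrightarrow>
     (\<forall>z\<in>ball 0 1. w differentiable (at z)) \<and> (\<exists>K. qr_bound w K)"

definition outer_dilatation :: "(complex \<Rightarrow> complex) \<Rightarrow> real" where
  "outer_dilatation w = Inf {K. qr_bound w K}"

definition int_mean :: "ereal \<Rightarrow> real \<Rightarrow> (complex \<Rightarrow> complex) \<Rightarrow> real" where
  "int_mean p r f =
     (if p = \<infinity> then (SUP \<theta>\<in>{0..2*pi}. cmod (f (of_real r * cis \<theta>)))
      else ((1 / (2 * pi)) * integral {0..2*pi} (\<lambda>\<theta>. cmod (f (of_real r * cis \<theta>)) powr real_of_ereal p))
            powr (1 / real_of_ereal p))"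

definition in_Hardy :: "ereal \<Rightarrow> (complex \<Rightarrow> complex) \<Rightarrow> bool" where
  "in_Hardy p f \<longleftrightarrow> f holomorphic_on ball 0 1 \<and> bdd_above ((\<lambda>r. int_mean p r f) ` {0<..<1})"

definition Hardy_norm :: "ereal \<Rightarrow> (complex \<Rightarrow> complex) \<Rightarrow> real" where
  "Hardy_norm p f = Lim (at_left 1) (\<lambda>r. int_mean p r f)"

definition in_Lp :: "ereal \<Rightarrow> (real \<Rightarrow> complex) \<Rightarrow> bool" where
  "in_Lp p G \<longleftrightarrow> set_borel_measurable lborel {0..2*pi} G \<and>
     (if p = \<infinity> then esssup (restrict_space lborel {0..2*pi}) (\<lambda>t. ereal (cmod (G t))) < \<infinity>
      else set_integrable lborel {0..2*pi} (\<lambda>t. cmod (G t) powr real_of_ereal p))"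

definition Lp_norm :: "ereal \<Rightarrow> (real \<Rightarrow> complex) \<Rightarrow> real" where
  "Lp_norm p G =
     (if p = \<infinity> then real_of_ereal (esssup (restrict_space lborel {0..2*pi}) (\<lambda>t. ereal (cmod (G t))))
      else ((1 / (2 * pi)) * (LINT t:{0..2*pi}|lborel. cmod (G t) powr real_of_ereal p))
            powr (1 / real_of_ereal p))"

end

theory Submission
  imports Defs "HOL-Complex_Analysis.Complex_Analysis"
begin

text \<open>
  The Poisson integral splits as \<open>w = g + cnj h\<close> with \<open>g\<close>, \<open>h\<close> holomorphic, so \<open>w_z = g'\<close> and
  \<open>cnj w_zbar = h'\<close>. Integrating by parts against the absolutely continuous boundary function shows that
  the angular derivative \<open>\<i> (z w_z - cnj z w_zbar)\<close> of \<open>w\<close> is the Poisson integral of \<open>Fdot\<close>.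
  Quasiregularity bounds \<open>|w_z|\<close> by \<open>(K + 1)/2\<close> and \<open>|w_zbar|\<close> by \<open>(K - 1)/2\<close> times
  \<open>|w_z| - |w_zbar|\<close>, which is at most \<open>1/r\<close> times the modulus of the angular derivative on \<open>|z| = r\<close>.
  By Jensen and Tonelli the Poisson integral contracts \<open>L\<^sup>p\<close>, which bounds the integral means; the same
  contraction, applied to the Poisson formula of a holomorphic function on a smaller disc, shows that
  integral means increase with \<open>r\<close>, so that the limit defining the Hardy norm exists.
\<close>

section \<open>Absolutely continuous functions\<close>

text \<open>Transfers the definition from families indexed by \<open>k<n\<close> to arbitrary finite
  index sets through an enumeration, so that the tagged pieces of a division can serve as
  indices.\<close>

lemma abs_continuous_onD:
  assumes "abs_continuous_on a b f" "\<epsilon> > 0"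
  obtains \<delta> where "\<delta> > 0"
    "\<forall>(I :: 'i set) u v. finite I \<longrightarrow> (\<forall>i\<in>I. a \<le> u i \<and> u i \<le> v i \<and> v i \<le> b) \<longrightarrow>
        (\<forall>i\<in>I. \<forall>j\<in>I. i \<noteq> j \<longrightarrow> v i \<le> u j \<or> v j \<le> u i) \<longrightarrow> (\<Sum>i\<in>I. v i - u i) < \<delta> \<longrightarrow>
        (\<Sum>i\<in>I. norm (f (v i) - f (u i))) < \<epsilon>"
proof -
  obtain \<delta> where "\<delta> > 0" and \<delta>: "\<forall>(n::nat) u v. (\<forall>k<n. a \<le> u k \<and> u k \<le> v k \<and> v k \<le> b) \<longrightarrow>
      (\<forall>i<n. \<forall>j<n. i \<noteq> j \<longrightarrow> v i \<le> u j \<or> v j \<le> u i) \<longrightarrow> (\<Sum>k<n. v k - u k) < \<delta> \<longrightarrow>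
      (\<Sum>k<n. norm (f (v k) - f (u k))) < \<epsilon>"
    using assms(1)[unfolded abs_continuous_on_def, THEN spec, THEN mp, OF assms(2)] by (elim exE conjE)
  show thesis
  proof (rule that[OF \<open>\<delta> > 0\<close>], intro allI impI)
    fix I :: "'i set" and u v
    assume "finite I" and uv: "\<forall>i\<in>I. a \<le> u i \<and> u i \<le> v i \<and> v i \<le> b"
      and dj: "\<forall>i\<in>I. \<forall>j\<in>I. i \<noteq> j \<longrightarrow> v i \<le> u j \<or> v j \<le> u i"
      and sm: "(\<Sum>i\<in>I. v i - u i) < \<delta>"
    obtain h where h: "bij_betw h {..<card I} I"
      using ex_bij_betw_nat_finite[OF \<open>finite I\<close>] lessThan_atLeast0 by metis
    have hI: "h k \<in> I" if "k < card I" for k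
      using h that by (auto simp: bij_betw_def)
    have hinj: "h i \<noteq> h j" if "i < card I" "j < card I" "i \<noteq> j" for i j
      using h that by (auto simp: bij_betw_def inj_on_def)
    have s: "(\<Sum>k<card I. g (h k)) = (\<Sum>i\<in>I. g i)" for g :: "'i \<Rightarrow> real"
      using sum.reindex_bij_betw[OF h] .
    have "(\<Sum>k<card I. norm (f (v (h k)) - f (u (h k)))) < \<epsilon>"
    proof (rule \<delta>[THEN spec, THEN spec, THEN spec, THEN mp, THEN mp, THEN mp])
      show "(\<Sum>k<card I. v (h k) - u (h k)) < \<delta>"
        using sm s[of "\<lambda>i. v i - u i"] by simp
    qed (use uv dj hI hinj in auto)
    then show "(\<Sum>i\<in>I. norm (f (v i) - f (u i))) < \<epsilon>"
      using s[of "\<lambda>i. norm (f (v i) - f (u i))"] by simp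
  qed
qed

lemma abs_continuous_on_imp_continuous_on:
  assumes "abs_continuous_on a b f"
  shows "continuous_on {a..b} f"
  unfolding continuous_on_iff
proof safe
  fix x e :: real assume x: "x \<in> {a..b}" and "e > 0"
  \<comment> \<open>A family consisting of one interval already gives uniform continuity.\<close>
  obtain \<delta> where "\<delta> > 0" and \<delta>:
    "\<forall>(I :: unit set) u v. finite I \<longrightarrow> (\<forall>i\<in>I. a \<le> u i \<and> u i \<le> v i \<and> v i \<le> b) \<longrightarrow>
        (\<forall>i\<in>I. \<forall>j\<in>I. i \<noteq> j \<longrightarrow> v i \<le> u j \<or> v j \<le> u i) \<longrightarrow> (\<Sum>i\<in>I. v i - u i) < \<delta> \<longrightarrow>
        (\<Sum>i\<in>I. norm (f (v i) - f (u i))) < e"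
    using abs_continuous_onD[OF assms \<open>e > 0\<close>, where 'i = unit] .
  have *: "norm (f v - f u) < e" if "a \<le> u" "u \<le> v" "v \<le> b" "v - u < \<delta>" for u v
    using \<delta>[rule_format, of UNIV "\<lambda>_. u" "\<lambda>_. v"] that by simp
  have "dist (f y) (f x) < e" if "y \<in> {a..b}" "dist y x < \<delta>" for y
    using *[of x y] *[of y x] x that by (cases "x \<le> y") (auto simp: dist_norm norm_minus_commute)
  then show "\<exists>d>0. \<forall>x'\<in>{a..b}. dist x' x < d \<longrightarrow> dist (f x') (f x) < e"
    using \<open>\<delta> > 0\<close> by blast
qed

text \<open>Each increment of the product is split as (increment of \<open>f\<close>) times
  \<open>g\<close> plus \<open>f\<close> times (increment of \<open>g\<close>); both factors are
  bounded on the compact interval. This prepares integration by parts against a smooth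
  kernel.\<close>

lemma abs_continuous_on_mult_lipschitz:
  fixes f g :: "real \<Rightarrow> 'a::real_normed_algebra"
  assumes f: "abs_continuous_on a b f" and g: "L-lipschitz_on {a..b} g"
  shows "abs_continuous_on a b (\<lambda>t. f t * g t)"
  unfolding abs_continuous_on_def
proof (intro allI impI)
  fix e :: real assume e: "e > 0"
  have "bounded (f ` {a..b})" "bounded (g ` {a..b})"
    using abs_continuous_on_imp_continuous_on[OF f] lipschitz_on_continuous_on[OF g]
    by (auto intro!: compact_imp_bounded compact_continuous_image)
  then obtain A B where A: "A > 0" "\<And>x. x \<in> {a..b} \<Longrightarrow> norm (f x) \<le> A"
    and B: "B > 0" "\<And>x. x \<in> {a..b} \<Longrightarrow> norm (g x) \<le> B"
    unfolding bounded_pos by blast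
  have L: "L \<ge> 0" using g lipschitz_on_nonneg by blast
  have "e / (2 * B) > 0" using e B by simp
  obtain d where "d > 0" and d:
    "\<forall>(I :: nat set) u v. finite I \<longrightarrow> (\<forall>i\<in>I. a \<le> u i \<and> u i \<le> v i \<and> v i \<le> b) \<longrightarrow>
        (\<forall>i\<in>I. \<forall>j\<in>I. i \<noteq> j \<longrightarrow> v i \<le> u j \<or> v j \<le> u i) \<longrightarrow> (\<Sum>i\<in>I. v i - u i) < d \<longrightarrow>
        (\<Sum>i\<in>I. norm (f (v i) - f (u i))) < e / (2 * B)"
    using abs_continuous_onD[OF f \<open>e / (2 * B) > 0\<close>, where 'i = nat] .
  \<comment> \<open>The first entry keeps the increments of \<open>f\<close> below e/2 after
    multiplication by \<open>B\<close>, the second does the same for those of \<open>g\<close>.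
    Using \<open>L + 1\<close> keeps the divisor positive when \<open>L\<close> is 0.\<close>
  define d' where "d' = min d (e / (2 * (A * (L + 1))))"
  show "\<exists>\<delta>>0. \<forall>(n::nat) u v. (\<forall>k<n. a \<le> u k \<and> u k \<le> v k \<and> v k \<le> b) \<longrightarrow>
      (\<forall>i<n. \<forall>j<n. i \<noteq> j \<longrightarrow> v i \<le> u j \<or> v j \<le> u i) \<longrightarrow> (\<Sum>k<n. v k - u k) < \<delta> \<longrightarrow>
      (\<Sum>k<n. norm (f (v k) * g (v k) - f (u k) * g (u k))) < e"
  proof (intro exI[of _ d'] conjI allI impI)
    show "d' > 0" using \<open>d > 0\<close> e A L by (simp add: d'_def)
  next
    fix n :: nat and u v :: "nat \<Rightarrow> real"
    assume uv: "\<forall>k<n. a \<le> u k \<and> u k \<le> v k \<and> v k \<le> b"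
      and dj: "\<forall>i<n. \<forall>j<n. i \<noteq> j \<longrightarrow> v i \<le> u j \<or> v j \<le> u i" and sm: "(\<Sum>k<n. v k - u k) < d'"
    have "norm (f (v k) * g (v k) - f (u k) * g (u k))
        \<le> B * norm (f (v k) - f (u k)) + A * (L + 1) * (v k - u k)" if "k < n" for k
    proof -
      have m: "u k \<in> {a..b}" "v k \<in> {a..b}" using uv that by force+
      have "f (v k) * g (v k) - f (u k) * g (u k)
          = (f (v k) - f (u k)) * g (v k) + f (u k) * (g (v k) - g (u k))"
        by (simp add: algebra_simps)
      also have "norm \<dots> \<le> norm (f (v k) - f (u k)) * norm (g (v k)) + norm (f (u k)) * norm (g (v k) - g (u k))"
        by (intro norm_triangle_mono norm_mult_ineq)
      also have "\<dots> \<le> norm (f (v k) - f (u k)) * B + A * ((L + 1) * (v k - u k))"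
      proof (intro add_mono mult_mono)
        have "norm (g (v k) - g (u k)) \<le> L * dist (v k) (u k)"
          using lipschitz_onD[OF g m(2,1)] by (simp add: dist_norm)
        also have "\<dots> \<le> (L + 1) * (v k - u k)"
          using uv that L by (intro mult_mono) (auto simp: dist_norm)
        finally show "norm (g (v k) - g (u k)) \<le> (L + 1) * (v k - u k)" .
      qed (use A B m in \<open>auto simp: less_imp_le\<close>)
      finally show ?thesis by (simp add: algebra_simps)
    qed
    then have "(\<Sum>k<n. norm (f (v k) * g (v k) - f (u k) * g (u k)))
        \<le> (\<Sum>k<n. B * norm (f (v k) - f (u k)) + A * (L + 1) * (v k - u k))"
      by (intro sum_mono) auto
    also have "\<dots> = B * (\<Sum>k<n. norm (f (v k) - f (u k))) + A * (L + 1) * (\<Sum>k<n. v k - u k)"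
      by (simp add: sum.distrib sum_distrib_left)
    also have "\<dots> < e / 2 + e / 2"
    proof (intro add_strict_mono)
      have "(\<Sum>k<n. norm (f (v k) - f (u k))) < e / (2 * B)"
        using uv dj sm by (intro d[rule_format]) (auto simp: d'_def)
      then show "B * (\<Sum>k<n. norm (f (v k) - f (u k))) < e / 2"
        using B by (simp add: field_simps)
      have "(\<Sum>k<n. v k - u k) < e / (2 * (A * (L + 1)))" using sm by (simp add: d'_def)
      then have "A * (L + 1) * (\<Sum>k<n. v k - u k) < A * (L + 1) * (e / (2 * (A * (L + 1))))"
        using A(1) L by (intro mult_strict_left_mono) auto
      also have "\<dots> = e / 2" using A(1) L nonzero_mult_divide_mult_cancel_left[of "A * (L + 1)" e 2] by simp
      finally show "A * (L + 1) * (\<Sum>k<n. v k - u k) < e / 2" .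
    qed
    finally show "(\<Sum>k<n. norm (f (v k) * g (v k) - f (u k) * g (u k))) < e" by simp
  qed
qed

text \<open>A gauge argument on tagged divisions. For tags outside \<open>N\<close> the derivative
  gives the usual straddle estimate. Intervals tagged in \<open>N\<close> lie in an open set of
  small measure, where absolute continuity makes the increments of \<open>f\<close> sum to
  little.\<close>

lemma abs_continuous_fundamental_theorem_of_calculus:
  fixes f :: "real \<Rightarrow> 'a::banach"
  assumes "a \<le> b" and ac: "abs_continuous_on a b f" and N: "negligible N"
    and f': "\<And>x. x \<in> {a..b} - N \<Longrightarrow> (f has_vector_derivative f' x) (at x within {a..b})"
  shows "(f' has_integral (f b - f a)) {a..b}"
proof -
  \<comment> \<open>With the integrand set to 0 on \<open>N\<close>, a tag in \<open>N\<close>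
    leaves only an increment of \<open>f\<close>. The change is undone at the end, since
    \<open>N\<close> is negligible.\<close>
  define g where "g x = (if x \<in> N then 0 else f' x)" for x
  have "(g has_integral (f b - f a)) (cbox a b)"
    unfolding has_integral
  proof (intro allI impI)
    fix e :: real assume e: "e > 0"
    \<comment> \<open>Half of \<open>e\<close> is spread over the length of the interval; the extra
      1 keeps the divisor positive when \<open>a = b\<close>.\<close>
    define e' where "e' = e / (2 * (b - a + 1))"
    have e': "e' > 0" using e \<open>a \<le> b\<close> by (simp add: e'_def)
    have e'e: "e' * (b - a) < e / 2" using e \<open>a \<le> b\<close> by (simp add: e'_def field_simps)
    have "\<forall>x. \<exists>d>0. x \<in> {a..b} - N \<longrightarrow>
         (\<forall>y\<in>{a..b}. norm (y-x) < d \<longrightarrow> norm (f y - f x - (y-x) *\<^sub>R f' x) \<le> e' * norm (y-x))"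
      using f'[unfolded has_vector_derivative_def has_derivative_within_alt] e' by (meson zero_less_one)
    then obtain d where d: "\<And>x. 0 < d x"
      "\<And>x y. \<lbrakk>x \<in> {a..b} - N; y \<in> {a..b}; norm (y-x) < d x\<rbrakk>
                        \<Longrightarrow> norm (f y - f x - (y-x) *\<^sub>R f' x) \<le> e' * norm (y-x)"
      by metis
    have "e / 2 > 0" using e by simp
    obtain \<delta> where "\<delta> > 0" and \<delta>:
      "\<forall>(I :: (real \<times> real set) set) u v. finite I \<longrightarrow> (\<forall>i\<in>I. a \<le> u i \<and> u i \<le> v i \<and> v i \<le> b) \<longrightarrow>
        (\<forall>i\<in>I. \<forall>j\<in>I. i \<noteq> j \<longrightarrow> v i \<le> u j \<or> v j \<le> u i) \<longrightarrow> (\<Sum>i\<in>I. v i - u i) < \<delta> \<longrightarrow>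
        (\<Sum>i\<in>I. norm (f (v i) - f (u i))) < e / 2"
      using abs_continuous_onD[OF ac \<open>e / 2 > 0\<close>, where 'i = "real \<times> real set"] .
    have N0: "N \<in> null_sets lebesgue" using N negligible_iff_null_sets by blast
    \<comment> \<open>Since \<open>N\<close> is null, an open cover \<open>U\<close> of
      \<open>N\<close> exceeding it by measure less than \<delta> itself has measure less than
      \<delta>.\<close>
    obtain U where U: "open U" "N \<subseteq> U" "(U - N) \<in> lmeasurable" "emeasure lebesgue (U - N) < ennreal \<delta>"
      using sets_lebesgue_outer_open[OF null_setsD2[OF N0] \<open>\<delta> > 0\<close>] .
    have Um: "emeasure lborel U < ennreal \<delta>"
    proof -
      have "emeasure lebesgue U = emeasure lebesgue ((U - N) \<union> N)"
        using U(2) by (simp add: Un_absorb2)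
      also have "\<dots> = emeasure lebesgue (U - N)"
        using U(3) N0 by (intro emeasure_Un_null_set) auto
      finally show ?thesis using U(1,4) by (simp add: borel_open)
    qed
    have "\<forall>x\<in>N. \<exists>r>0. ball x r \<subseteq> U" using U(1,2) openE by blast
    then obtain r where r: "\<And>x. x \<in> N \<Longrightarrow> r x > 0 \<and> ball x (r x) \<subseteq> U" by metis
    \<comment> \<open>At points of \<open>N\<close> the gauge keeps the interval inside
      \<open>U\<close>; elsewhere it is the radius of the derivative estimate.\<close>
    define \<rho> where "\<rho> x = (if x \<in> N then r x else d x)" for x
    show "\<exists>\<gamma>. gauge \<gamma> \<and> (\<forall>D. D tagged_division_of cbox a b \<and> \<gamma> fine D \<longrightarrow>
        norm ((\<Sum>(x, k)\<in>D. measure lborel k *\<^sub>R g x) - (f b - f a)) < e)"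
    proof (intro exI[of _ "\<lambda>x. ball x (\<rho> x)"] conjI allI impI; (elim conjE)?)
      show "gauge (\<lambda>x. ball x (\<rho> x))"
        using d(1) r by (intro gauge_ball_dependent) (auto simp: \<rho>_def)
    next
      fix p assume p: "p tagged_division_of cbox a b" and fine: "(\<lambda>x. ball x (\<rho> x)) fine p"
      have ba: "b - a = (\<Sum>(x,K)\<in>p. Sup K - Inf K)" "f b - f a = (\<Sum>(x,K)\<in>p. f(Sup K) - f(Inf K))"
        using additive_tagged_division_1[where f= "\<lambda>x. x"] additive_tagged_division_1[where f= f]
          \<open>a \<le> b\<close> p by auto
      have finp: "finite p" using p by (rule tagged_division_ofD(1))
      have K: "\<exists>u v. K = {u..v} \<and> a \<le> u \<and> u \<le> x \<and> x \<le> v \<and> v \<le> b \<and> Inf K = u \<and> Sup K = v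
          \<and> measure lborel K = v - u \<and> interior K = {u<..<v} \<and> K \<subseteq> ball x (\<rho> x)" if xK: "(x, K) \<in> p" for x K
      proof -
        have "x \<in> K" "K \<subseteq> cbox a b"
          using tagged_division_ofD(2,3)[OF p xK] .
        moreover obtain u v where k: "K = cbox u v"
          using tagged_division_ofD(4)[OF p xK] by blast
        moreover have "K \<subseteq> ball x (\<rho> x)" using fine xK by (auto simp: fine_def)
        ultimately have "K = {u..v}" "a \<le> u" "u \<le> x" "x \<le> v" "v \<le> b" "K \<subseteq> ball x (\<rho> x)"
          by auto
        then show ?thesis by (intro exI[of _ u] exI[of _ v]) auto
      qed
      define D where "D = (\<lambda>(x, K). measure lborel K *\<^sub>R g x - (f (Sup K) - f (Inf K)))"
      \<comment> \<open>Degenerate intervals are left out: a single point may lie inside another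
        interval of the division, which would break the ordering demanded by absolute continuity.
        Their terms in \<open>D\<close> vanish anyway.\<close>
      define p1 where "p1 = {(x, K) \<in> p. x \<in> N \<and> measure lborel K \<noteq> 0}"
      have p1p: "p1 \<subseteq> p" by (auto simp: p1_def)
      have finp1: "finite p1" using finp p1p finite_subset by blast
      have "(\<Sum>(x, k)\<in>p. measure lborel k *\<^sub>R g x) - (f b - f a) = sum D p"
        unfolding ba(2) D_def by (simp add: sum_subtractf case_prod_unfold)
      also have "\<dots> = sum D (p - p1) + sum D p1"
        using finp p1p by (rule sum.subset_diff[rotated])
      also have "norm \<dots> \<le> norm (sum D (p - p1)) + norm (sum D p1)" by (rule norm_triangle_ineq)
      also have "\<dots> < e / 2 + e / 2"
      proof (rule add_strict_mono)
        have "norm (sum D (p - p1)) \<le> (\<Sum>n\<in>p - p1. e' * (case n of (x, k) \<Rightarrow> Sup k - Inf k))"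
        proof (rule sum_norm_le, safe)
          fix x K assume xK: "(x, K) \<in> p" "(x, K) \<notin> p1"
          obtain u v where k: "K = {u..v}" "a \<le> u" "u \<le> x" "x \<le> v" "v \<le> b" "Inf K = u" "Sup K = v"
            "measure lborel K = v - u" "K \<subseteq> ball x (\<rho> x)" using K[OF xK(1)] by blast
          show "norm (D (x, K)) \<le> e' * (Sup K - Inf K)"
          proof (cases "x \<in> N")
            case True
            then have "v = u" using xK k by (auto simp: p1_def)
            then show ?thesis using k by (simp add: D_def)
          next
            case False
            have b: "\<bar>u - x\<bar> < d x" "\<bar>v - x\<bar> < d x"
              using subsetD[OF k(9), of u] subsetD[OF k(9), of v] k(1-5) False
              by (auto simp: \<rho>_def dist_real_def)
            \<comment> \<open>Straddle identity: both endpoints are compared with the tag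
              \<open>x\<close>, which lies between them, so the two errors add up to
              \<open>e'\<close> times the length.\<close>
            have "norm (D (x, K)) = norm ((f u - f x - (u - x) *\<^sub>R f' x) - (f v - f x - (v - x) *\<^sub>R f' x))"
              using k False by (simp add: D_def g_def algebra_simps)
            also have "\<dots> \<le> norm (f u - f x - (u - x) *\<^sub>R f' x) + norm (f v - f x - (v - x) *\<^sub>R f' x)"
              by (rule norm_triangle_ineq4)
            also have "\<dots> \<le> e' * norm (u - x) + e' * norm (v - x)"
              using k False b by (intro add_mono d(2)) auto
            also have "\<dots> = e' * (Sup K - Inf K)" using k by (simp add: algebra_simps)
            finally show ?thesis .
          qed
        qed
        also have "\<dots> \<le> (\<Sum>n\<in>p. e' * (case n of (x, k) \<Rightarrow> Sup k - Inf k))"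
        proof (rule sum_mono2[OF finp])
          show "0 \<le> e' * (case n of (x, k) \<Rightarrow> Sup k - Inf k)" if "n \<in> p - (p - p1)" for n
            using that e' K[of "fst n" "snd n"] by (auto intro!: mult_nonneg_nonneg split: prod.splits)
        qed auto
        also have "\<dots> = e' * (b - a)" unfolding ba(1) by (simp add: sum_distrib_left)
        finally show "norm (sum D (p - p1)) < e / 2" using e'e by linarith
      next
        have K1: "a \<le> Inf (snd i)" "Inf (snd i) < Sup (snd i)" "Sup (snd i) \<le> b" "fst i \<in> N"
          "interior (snd i) = {Inf (snd i)<..<Sup (snd i)}" "snd i \<subseteq> ball (fst i) (r (fst i))"
          if "i \<in> p1" for i
        proof -
          have "(fst i, snd i) \<in> p" and i: "fst i \<in> N" "measure lborel (snd i) \<noteq> 0"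
            using that by (auto simp: p1_def)
          from K[OF this(1)] obtain u v where k: "snd i = {u..v}" "a \<le> u" "u \<le> fst i" "fst i \<le> v" "v \<le> b"
            "Inf (snd i) = u" "Sup (snd i) = v" "measure lborel (snd i) = v - u"
            "interior (snd i) = {u<..<v}" "snd i \<subseteq> ball (fst i) (\<rho> (fst i))" by blast
          show "a \<le> Inf (snd i)" "Inf (snd i) < Sup (snd i)" "Sup (snd i) \<le> b" "fst i \<in> N"
            "interior (snd i) = {Inf (snd i)<..<Sup (snd i)}" "snd i \<subseteq> ball (fst i) (r (fst i))"
            using k i by (auto simp: \<rho>_def)
        qed
        have "norm (sum D p1) \<le> (\<Sum>n\<in>p1. norm (f (Sup (snd n)) - f (Inf (snd n))))"
          by (rule sum_norm_le) (auto simp: p1_def D_def g_def norm_minus_commute)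
        also have "\<dots> < e / 2"
        proof (rule \<delta>[THEN spec[of _ p1], THEN spec[of _ "\<lambda>i. Inf (snd i)"], THEN spec[of _ "\<lambda>i. Sup (snd i)"],
              THEN mp, THEN mp, THEN mp, THEN mp, OF finp1])
          show "\<forall>i\<in>p1. a \<le> Inf (snd i) \<and> Inf (snd i) \<le> Sup (snd i) \<and> Sup (snd i) \<le> b"
            by (intro ballI conjI K1(1,3) less_imp_le[OF K1(2)])
          have dis: "interior (snd i) \<inter> interior (snd j) = {}" if "i \<in> p1" "j \<in> p1" "i \<noteq> j" for i j
            using tagged_division_ofD(5)[OF p, of "fst i" "snd i" "fst j" "snd j"] that p1p by auto
          show "\<forall>i\<in>p1. \<forall>j\<in>p1. i \<noteq> j \<longrightarrow>
              Sup (snd i) \<le> Inf (snd j) \<or> Sup (snd j) \<le> Inf (snd i)"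
          proof (intro ballI impI, rule ccontr)
            fix i j assume ij: "i \<in> p1" "j \<in> p1" "i \<noteq> j"
              and c: "\<not> (Sup (snd i) \<le> Inf (snd j) \<or> Sup (snd j) \<le> Inf (snd i))"
            \<comment> \<open>Two intervals of positive length that overlap would share an interior
              point.\<close>
            have "max (Inf (snd i)) (Inf (snd j)) < min (Sup (snd i)) (Sup (snd j))"
              using c K1[OF ij(1)] K1[OF ij(2)] by auto
            then obtain z where "max (Inf (snd i)) (Inf (snd j)) < z" "z < min (Sup (snd i)) (Sup (snd j))"
              using dense by blast
            then show False using dis[OF ij] K1(5)[OF ij(1)] K1(5)[OF ij(2)] by auto
          qed
          \<comment> \<open>The total length is the measure of a disjoint union of open intervals
            inside \<open>U\<close>, hence less than \<delta>.\<close>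
          have "ennreal (\<Sum>i\<in>p1. Sup (snd i) - Inf (snd i)) = (\<Sum>i\<in>p1. ennreal (Sup (snd i) - Inf (snd i)))"
            using K1(2) by (intro sum_ennreal[symmetric]) force
          also have "\<dots> = (\<Sum>i\<in>p1. emeasure lborel (interior (snd i)))"
          proof (rule sum.cong[OF refl])
            fix i assume "i \<in> p1"
            then show "ennreal (Sup (snd i) - Inf (snd i)) = emeasure lborel (interior (snd i))"
              using K1(2,5)[of i] by simp
          qed
          also have "\<dots> = emeasure lborel (\<Union>i\<in>p1. interior (snd i))"
            using dis finp1 by (intro sum_emeasure) (auto simp: disjoint_family_on_def)
          also have "\<dots> \<le> emeasure lborel U"
          proof (rule emeasure_mono)
            show "(\<Union>i\<in>p1. interior (snd i)) \<subseteq> U"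
            proof (rule UN_least)
              fix i assume i: "i \<in> p1"
              show "interior (snd i) \<subseteq> U"
                using K1(4,6)[OF i] r interior_subset by blast
            qed
          qed (use U in \<open>simp add: borel_open\<close>)
          also note Um
          finally show "(\<Sum>i\<in>p1. Sup (snd i) - Inf (snd i)) < \<delta>"
            using K1(2) by (subst (asm) ennreal_less_iff) (force intro!: sum_nonneg)+
        qed
        finally show "norm (sum D p1) < e / 2" .
      qed
      finally show "norm ((\<Sum>(x, k)\<in>p. measure lborel k *\<^sub>R g x) - (f b - f a)) < e" by simp
    qed
  qed
  then have "(g has_integral (f b - f a)) {a..b}" by simp
  then show ?thesis
    by (rule has_integral_spike[OF N, rotated]) (auto simp: g_def)
qed

section \<open>The Poisson kernel\<close>

lemma norm_cis_minus_polar_squared: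
  "(cmod (cis t - of_real r * cis \<phi>))\<^sup>2 = 1 - 2 * r * cos (t - \<phi>) + r\<^sup>2"
proof -
  have "(cmod (cis t - of_real r * cis \<phi>))\<^sup>2 = (cos t - r * cos \<phi>)\<^sup>2 + (sin t - r * sin \<phi>)\<^sup>2"
    by (simp add: cmod_power2)
  also have "\<dots> = ((cos t)\<^sup>2 + (sin t)\<^sup>2) - 2 * r * (cos t * cos \<phi> + sin t * sin \<phi>) + r\<^sup>2 * ((cos \<phi>)\<^sup>2 + (sin \<phi>)\<^sup>2)"
    by algebra
  finally show ?thesis by (simp add: cos_diff)
qed

lemma poisson_kernel_eq:
  "poisson_kernel r (t - \<phi>) = (1 - r\<^sup>2) / (2 * pi * (cmod (cis t - of_real r * cis \<phi>))\<^sup>2)"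
  unfolding poisson_kernel_def norm_cis_minus_polar_squared by simp

lemma poisson_kernel_cmod_Arg:
  "poisson_kernel (cmod z) (t - Arg z) = (1 - (cmod z)\<^sup>2) / (2 * pi * (cmod (cis t - z))\<^sup>2)"
  using poisson_kernel_eq[of "cmod z" t "Arg z"] by (simp add: rcis_def[symmetric] rcis_cmod_Arg)

text \<open>\<open>Arg\<close> returns the principal argument, which may differ from \<phi>.
  Expressed through the distance from \<open>cis t\<close> to the point, the kernel does not depend
  on the choice of angle.\<close>

lemma poisson_kernel_Arg_polar:
  assumes "r \<ge> 0"
  shows "poisson_kernel r (t - Arg (of_real r * cis \<phi>)) = poisson_kernel r (t - \<phi>)"
  using assms poisson_kernel_cmod_Arg[of "of_real r * cis \<phi>" t] unfolding poisson_kernel_eq[of r t \<phi>]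
  by (simp add: norm_mult)

lemma cis_neq: "cmod z < 1 \<Longrightarrow> cis t \<noteq> z"
  by (metis less_irrefl norm_cis)

lemma poisson_kernel_denominator_pos:
  fixes s :: real
  assumes "0 \<le> s" "s < 1"
  shows "1 - 2 * s * cos x + s\<^sup>2 > 0"
proof -
  have "1 - 2 * s * cos x + s\<^sup>2 = (1 - s)\<^sup>2 + 2 * s * (1 - cos x)"
    by (simp add: power2_eq_square algebra_simps)
  moreover have "2 * s * (1 - cos x) \<ge> 0" using assms by simp
  moreover have "(1 - s)\<^sup>2 > 0" using assms by simp
  ultimately show ?thesis by linarith
qed

lemma poisson_kernel_nonneg: "\<lbrakk>0 \<le> s; s < 1\<rbrakk> \<Longrightarrow> 0 \<le> poisson_kernel s x"
  using poisson_kernel_denominator_pos[of s x] 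
  unfolding poisson_kernel_def by (simp add: power_le_one less_imp_le)

lemma poisson_kernel_le:
  assumes "0 \<le> s" "s < 1"
  shows "poisson_kernel s x \<le> (1 - s\<^sup>2) / (2 * pi * (1 - s)\<^sup>2)"
proof -
  have "1 - 2 * s * cos x + s\<^sup>2 = (1 - s)\<^sup>2 + 2 * s * (1 - cos x)"
    by (simp add: power2_eq_square algebra_simps)
  moreover have "2 * s * (1 - cos x) \<ge> 0" using assms by simp
  ultimately have "(1 - s)\<^sup>2 \<le> 1 - 2 * s * cos x + s\<^sup>2" by linarith
  moreover have "(1 - s)\<^sup>2 > 0" using assms by simp
  moreover note poisson_kernel_denominator_pos[OF assms, of x]
  moreover have "1 - s\<^sup>2 \<ge> 0" using assms by (simp add: power_le_one)
  ultimately have "(1 - s\<^sup>2) / (1 - 2 * s * cos x + s\<^sup>2) \<le> (1 - s\<^sup>2) / (1 - s)\<^sup>2"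
    by (intro divide_left_mono mult_pos_pos) auto
  then have "1 / (2 * pi) * ((1 - s\<^sup>2) / (1 - 2 * s * cos x + s\<^sup>2)) \<le> 1 / (2 * pi) * ((1 - s\<^sup>2) / (1 - s)\<^sup>2)"
    by (intro mult_left_mono) auto
  then show ?thesis unfolding poisson_kernel_def by simp
qed

lemma continuous_on_poisson_kernel [continuous_intros]:
  fixes h :: "real \<Rightarrow> real"
  assumes "0 \<le> s" "s < 1" "continuous_on A h"
  shows "continuous_on A (\<lambda>x. poisson_kernel s (h x))"
  unfolding poisson_kernel_def
  using assms by (intro continuous_intros) (auto simp: poisson_kernel_denominator_pos less_imp_neq[symmetric])

lemma poisson_kernel_minus: "poisson_kernel s (x - y) = poisson_kernel s (y - x)"
  unfolding poisson_kernel_def by (simp add: cos_diff mult.commute)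

text \<open>Cauchy's formula at \<open>z\<close> for \<open>f u (1 - |z|\<^sup>2) / (1 - cnj z u)\<close>, whose value at \<open>z\<close> is \<open>f z\<close>.\<close>
lemma poisson_formula_holomorphic:
  assumes "continuous_on (cball 0 1) f" "f holomorphic_on ball 0 1" "cmod z < 1"
  shows "((\<lambda>t. of_real (poisson_kernel (cmod z) (t - Arg z)) * f (cis t)) has_integral f z) {0..2*pi}"
proof -
  have nz: "1 - cnj z * u \<noteq> 0" if "cmod u \<le> 1" for u
  proof
    assume "1 - cnj z * u = 0"
    then have "cmod (cnj z * u) = 1" by (metis eq_iff_diff_eq_0 norm_one)
    then have "cmod z * cmod u = 1" by (simp add: norm_mult)
    moreover have "cmod z * cmod u \<le> cmod z * 1" using that by (intro mult_left_mono) auto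
    ultimately show False using assms(3) by simp
  qed
  define h where "h u = f u * (1 - of_real ((cmod z)\<^sup>2)) / (1 - cnj z * u)" for u
  have zz: "1 - cnj z * z = 1 - of_real ((cmod z)\<^sup>2)"
    by (metis complex_norm_square mult.commute of_real_power)
  have "h z = f z" using nz[of z] assms(3) unfolding h_def zz by simp
  have c: "continuous_on (cball 0 1) h"
    unfolding h_def using nz assms(1) by (intro continuous_intros) auto
  have hol: "h holomorphic_on ball 0 1"
    unfolding h_def using nz assms(2) by (intro holomorphic_intros) auto
  have "((\<lambda>u. h u / (u - z)) has_contour_integral (2 * of_real pi * \<i> * h z)) (circlepath 0 1)"
    using Cauchy_integral_circlepath[OF c hol] assms(3) by simp
  then have "((\<lambda>t. h (cis t) / (cis t - z) * \<i> * cis t) has_integral (2 * of_real pi * \<i> * f z)) {0..2*pi}"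
    unfolding circlepath_def using \<open>h z = f z\<close>
    by (subst (asm) has_contour_integral_part_circlepath_iff) auto
  then have "((\<lambda>t. (1 / (2 * of_real pi * \<i>)) * (h (cis t) / (cis t - z) * \<i> * cis t)) has_integral
      (1 / (2 * of_real pi * \<i>)) * (2 * of_real pi * \<i> * f z)) {0..2*pi}"
    by (rule has_integral_mult_right)
  moreover have "(1 / (2 * of_real pi * \<i>)) * (h (cis t) / (cis t - z) * \<i> * cis t)
      = of_real (poisson_kernel (cmod z) (t - Arg z)) * f (cis t)" for t
  proof -
    have 1: "cis t - z \<noteq> 0" "cnj (cis t - z) \<noteq> 0"
      using cis_neq[OF assms(3)] by (simp_all only: complex_cnj_zero_iff right_minus_eq not_False_eq_True)
    \<comment> \<open>On the unit circle the auxiliary denominator becomes \<open>cis t\<close>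
      times the conjugate of \<open>cis t - z\<close>; together with the Cauchy denominator this
      yields the squared modulus in the Poisson kernel.\<close>
    have "1 - cnj z * cis t = cis t * cnj (cis t - z)"
      by (simp add: algebra_simps cis_cnj cis_mult)
    then have "h (cis t) * cis t = f (cis t) * (1 - of_real ((cmod z)\<^sup>2)) / cnj (cis t - z)"
      unfolding h_def by simp
    moreover have "(1 / (2 * of_real pi * \<i>)) * (h (cis t) / (cis t - z) * \<i> * cis t)
       = h (cis t) * cis t / (2 * of_real pi * (cis t - z))" by simp
    ultimately have "(1 / (2 * of_real pi * \<i>)) * (h (cis t) / (cis t - z) * \<i> * cis t)
       = f (cis t) * (1 - of_real ((cmod z)\<^sup>2)) / (2 * of_real pi * ((cis t - z) * cnj (cis t - z)))"
      by (simp only: divide_divide_eq_left mult_ac)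
    also have "(cis t - z) * cnj (cis t - z) = of_real ((cmod (cis t - z))\<^sup>2)"
      by (metis complex_norm_square of_real_power)
    finally show ?thesis unfolding poisson_kernel_cmod_Arg by (simp add: field_simps)
  qed
  ultimately show ?thesis by simp
qed

text \<open>The Poisson formula for the constant function 1. Evenness of the kernel allows
  integration over either angle, and both versions are used below.\<close>

lemma has_integral_poisson_kernel:
  assumes "0 \<le> s" "s < 1"
  shows "((\<lambda>\<theta>. poisson_kernel s (t - \<theta>)) has_integral 1) {0..2*pi}"
proof -
  have "((\<lambda>\<theta>. of_real (poisson_kernel s (\<theta> - t)) * (1::complex)) has_integral 1) {0..2*pi}"
    using poisson_formula_holomorphic[of "\<lambda>_. 1" "of_real s * cis t"] assms
    by (simp add: norm_mult poisson_kernel_Arg_polar)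
  then have "((\<lambda>\<theta>. Re (of_real (poisson_kernel s (\<theta> - t)) * (1::complex))) has_integral Re 1) {0..2*pi}"
    by (rule has_integral_Re)
  then show ?thesis by (simp add: poisson_kernel_minus[of s t])
qed

section \<open>Contraction of integral means\<close>

text \<open>A convex function lies above its tangent at \<open>m\<close>. The endpoint
  \<open>x = 0\<close> is outside the open half-line of the tangent argument and is checked by
  hand.\<close>

lemma powr_tangent:
  fixes x m p :: real
  assumes "p \<ge> 1" "x \<ge> 0" "m > 0"
  shows "m powr p + p * m powr (p - 1) * (x - m) \<le> x powr p"
proof (cases "x = 0")
  case True
  have "m powr p + p * m powr (p - 1) * (x - m) = (1 - p) * m powr p"
    using assms True by (simp add: powr_diff field_simps)
  also have "\<dots> \<le> 0" using assms by (simp add: mult_nonpos_nonneg)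
  finally show ?thesis using True by simp
next
  case False
  have "p * m powr (p - 1) * (x - m) \<le> x powr p - m powr p"
  proof (rule convex_on_imp_above_tangent[where A = "{0<..}"])
    show "((\<lambda>x. x powr p) has_real_derivative p * m powr (p - 1)) (at m within {0<..})"
      using assms by (auto intro!: derivative_eq_intros)
  qed (use assms False in \<open>auto simp: powr_convex interior_open\<close>)
  then show ?thesis by simp
qed

text \<open>Jensen's inequality for the probability density \<open>k\<close>: the tangent inequality
  at the weighted mean \<open>m\<close>, with slope \<open>c\<close>, is integrated against
  \<open>k\<close>, and the linear term cancels. The tangent needs \<open>m > 0\<close>; for
  \<open>m = 0\<close> the left side is 0.\<close>

lemma jensen_powr_weighted:
  fixes k g :: "'a \<Rightarrow> real"
  assumes "p \<ge> 1" and k: "\<And>x. k x \<ge> 0" "integrable M k" "(\<integral>x. k x \<partial>M) = 1"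
    and g: "\<And>x. g x \<ge> 0" "integrable M (\<lambda>x. k x * g x)" "integrable M (\<lambda>x. k x * g x powr p)"
  shows "(\<integral>x. k x * g x \<partial>M) powr p \<le> (\<integral>x. k x * g x powr p \<partial>M)"
proof -
  define m where "m = (\<integral>x. k x * g x \<partial>M)"
  have "m \<ge> 0" unfolding m_def using k g by (intro integral_nonneg_AE) auto
  show ?thesis
  proof (cases "m = 0")
    case True
    have "(\<integral>x. k x * g x powr p \<partial>M) \<ge> 0" using k by (intro integral_nonneg_AE) auto
    then show ?thesis using True m_def by simp
  next
    case False
    then have m: "m > 0" using \<open>m \<ge> 0\<close> by simp
    define c where "c = p * m powr (p - 1)"
    have i: "integrable M (\<lambda>x. (m powr p - c * m) * k x + c * (k x * g x))"
      using k g by (intro Bochner_Integration.integrable_add integrable_mult_right) auto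
    have "m powr p = (\<integral>x. (m powr p - c * m) * k x + c * (k x * g x) \<partial>M)"
      using k g by (subst Bochner_Integration.integral_add) (auto simp: m_def[symmetric])
    also have "\<dots> \<le> (\<integral>x. k x * g x powr p \<partial>M)"
    proof (rule integral_mono[OF i g(3)])
      fix x
      have "k x * (m powr p + c * (g x - m)) \<le> k x * g x powr p"
        unfolding c_def using k(1) g(1) powr_tangent[OF \<open>p \<ge> 1\<close> _ m] by (intro mult_left_mono) auto
      then show "(m powr p - c * m) * k x + c * (k x * g x) \<le> k x * g x powr p"
        by (simp add: algebra_simps)
    qed
    finally show ?thesis unfolding m_def .
  qed
qed

text \<open>On a bounded interval the constant 1 is integrable, and x \<le> 1 +
  \<open>x powr q\<close> for x \<ge> 0 and q \<ge> 1.\<close>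

lemma set_integrable_of_powr:
  fixes G :: "real \<Rightarrow> complex"
  assumes "q \<ge> 1" "set_borel_measurable lborel {a..b} G"
    and "set_integrable lborel {a..b} (\<lambda>t. cmod (G t) powr q)"
  shows "set_integrable lborel {a..b} G"
proof -
  have "set_integrable lborel {a..b} (\<lambda>t. 1 + cmod (G t) powr q)"
    using assms(3) by (intro set_integral_add) (auto simp: borel_integrable_atLeastAtMost')
  then show ?thesis
  proof (rule set_integrable_bound)
    show "AE x in lborel. x \<in> {a..b} \<longrightarrow> norm (G x) \<le> norm (1 + cmod (G x) powr q)"
    proof (intro always_eventually allI impI)
      fix x
      have "cmod (G x) \<le> 1 + cmod (G x) powr q"
      proof (cases "cmod (G x) \<le> 1")
        case False
        then have "cmod (G x) powr 1 \<le> cmod (G x) powr q" using assms(1) by (intro powr_mono) auto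
        then show ?thesis using False by simp
      qed (simp add: add_increasing2)
      then show "norm (G x) \<le> norm (1 + cmod (G x) powr q)" by simp
    qed
  qed (use assms in auto)
qed

text \<open>For fixed \<open>s < 1\<close> the kernel is continuous and bounded by a constant, so
  the product is dominated by a multiple of \<open>g\<close>.\<close>

lemma set_integrable_poisson_kernel_mult:
  fixes g :: "real \<Rightarrow> 'a::{banach, second_countable_topology}"
  assumes "0 \<le> s" "s < 1" and g: "set_integrable lborel A g"
  shows "set_integrable lborel A (\<lambda>t. poisson_kernel s (t - \<theta>) *\<^sub>R g t)"
proof -
  define C where "C = (1 - s\<^sup>2) / (2 * pi * (1 - s)\<^sup>2)"
  have "(\<lambda>t. poisson_kernel s (t - \<theta>)) \<in> borel_measurable borel"
    using assms by (intro borel_measurable_continuous_onI continuous_intros)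
  then have m: "(\<lambda>t. poisson_kernel s (t - \<theta>)) \<in> borel_measurable lborel" by simp
  have i: "integrable lborel (\<lambda>t. indicator A t *\<^sub>R g t)" using g by (simp add: set_integrable_def)
  have "integrable lborel (\<lambda>t. poisson_kernel s (t - \<theta>) *\<^sub>R (indicator A t *\<^sub>R g t))"
  proof (rule Bochner_Integration.integrable_bound[where f = "\<lambda>t. C *\<^sub>R (indicator A t *\<^sub>R g t)"])
    show "AE t in lborel. norm (poisson_kernel s (t - \<theta>) *\<^sub>R (indicator A t *\<^sub>R g t))
        \<le> norm (C *\<^sub>R (indicator A t *\<^sub>R g t))"
    proof (intro always_eventually allI)
      fix t
      have "norm (poisson_kernel s (t - \<theta>)) \<le> norm C"
        using poisson_kernel_nonneg[OF assms(1,2), of "t - \<theta>"] poisson_kernel_le[OF assms(1,2), of "t - \<theta>", folded C_def]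
        by simp
      then show "norm (poisson_kernel s (t - \<theta>) *\<^sub>R (indicator A t *\<^sub>R g t))
        \<le> norm (C *\<^sub>R (indicator A t *\<^sub>R g t))"
        by (simp only: norm_scaleR) (intro mult_right_mono, auto)
    qed
    show "integrable lborel (\<lambda>t. C *\<^sub>R (indicator A t *\<^sub>R g t))"
      using i by (intro integrable_scaleR_right) auto
    show "(\<lambda>t. poisson_kernel s (t - \<theta>) *\<^sub>R (indicator A t *\<^sub>R g t)) \<in> borel_measurable lborel"
      using m borel_measurable_integrable[OF i] by (rule borel_measurable_scaleR)
  qed
  then show ?thesis
    unfolding set_integrable_def by (simp add: mult.commute)
qed

text \<open>Jensen is applied for each \<theta> to the kernel as a density in t. Tonelli then allows
  integration in \<theta> first, where the kernel has mass 1 again and disappears.\<close>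

lemma poisson_mean_powr_bound:
  fixes G :: "real \<Rightarrow> complex" and u :: "real \<Rightarrow> real"
  assumes q: "q \<ge> 1" and s: "0 \<le> s" "s < 1" and c: "c \<ge> 0"
    and G: "set_borel_measurable lborel {0..2*pi} G"
    and Gq: "set_integrable lborel {0..2*pi} (\<lambda>t. cmod (G t) powr q)"
    and u: "continuous_on {0..2*pi} u" "\<And>\<theta>. \<theta> \<in> {0..2*pi} \<Longrightarrow> 0 \<le> u \<theta>"
    and le: "\<And>\<theta>. \<theta> \<in> {0..2*pi} \<Longrightarrow>
      u \<theta> \<le> c * (LINT t:{0..2*pi}|lborel. poisson_kernel s (t - \<theta>) * cmod (G t))"
  shows "integral {0..2*pi} (\<lambda>\<theta>. u \<theta> powr q)
      \<le> c powr q * (LINT t:{0..2*pi}|lborel. cmod (G t) powr q)"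
proof -
  let ?I = "\<lambda>t::real. indicator {0..2*pi} t :: real"
  let ?P = "\<lambda>\<theta> t. poisson_kernel s (t - \<theta>)"
  define gq where "gq t = ?I t * cmod (G t) powr q" for t
  have gq: "integrable lborel gq"
    using Gq unfolding set_integrable_def gq_def by simp
  have gq0: "gq t \<ge> 0" for t by (simp add: gq_def)
  have P0: "?P \<theta> t \<ge> 0" for \<theta> t using poisson_kernel_nonneg[OF s] .
  have pw: "u \<theta> powr q \<le> (\<integral>t. c powr q * (?P \<theta> t * gq t) \<partial>lborel)"
    if \<theta>: "\<theta> \<in> {0..2*pi}" for \<theta>
  proof -
    have hp: "(?P \<theta> has_integral 1) {0..2*pi}"
      using has_integral_poisson_kernel[OF s, of \<theta>] by (simp add: poisson_kernel_minus[of s \<theta>])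
    have k: "set_integrable lborel {0..2*pi} (?P \<theta>)"
      using s by (intro borel_integrable_atLeastAtMost' continuous_intros)
    have k1: "(LINT t:{0..2*pi}|lborel. ?P \<theta> t) = 1"
      using set_borel_integral_eq_integral(2)[OF k] hp by (simp add: integral_unique)
    have kg: "set_integrable lborel {0..2*pi} (\<lambda>t. ?P \<theta> t * cmod (G t))"
      using set_integrable_poisson_kernel_mult[OF s set_integrable_norm[OF set_integrable_of_powr[OF q G Gq]]] by simp
    have kgq: "set_integrable lborel {0..2*pi} (\<lambda>t. ?P \<theta> t * cmod (G t) powr q)"
      using set_integrable_poisson_kernel_mult[OF s Gq] by simp
    have "u \<theta> powr q \<le> (c * (LINT t:{0..2*pi}|lborel. ?P \<theta> t * cmod (G t))) powr q"
      using u le \<theta> q by (intro powr_mono2) auto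
    also have "\<dots> = c powr q * (\<integral>t. (?I t * ?P \<theta> t) * cmod (G t) \<partial>lborel) powr q"
      using c P0 by (simp add: powr_mult set_lebesgue_integral_def mult.assoc)
    also have "\<dots> \<le> c powr q * (\<integral>t. (?I t * ?P \<theta> t) * cmod (G t) powr q \<partial>lborel)"
      using q P0 k k1 kg kgq
      by (intro mult_left_mono jensen_powr_weighted)
        (auto simp: set_integrable_def set_lebesgue_integral_def mult.assoc)
    also have "\<dots> = (\<integral>t. c powr q * (?P \<theta> t * gq t) \<partial>lborel)"
      by (simp add: gq_def mult_ac)
    finally show ?thesis .
  qed
  have uq: "continuous_on {0..2*pi} (\<lambda>\<theta>. u \<theta> powr q)"
    using u q by (intro continuous_on_powr') auto
  then have ui: "set_integrable lborel {0..2*pi} (\<lambda>\<theta>. u \<theta> powr q)"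
    by (rule borel_integrable_atLeastAtMost')
  \<comment> \<open>From here on the integrals are taken in the extended nonnegative reals, so that
    exchanging their order requires only joint measurability.\<close>
  have "ennreal (integral {0..2*pi} (\<lambda>\<theta>. u \<theta> powr q)) = ennreal (\<integral>\<theta>. ?I \<theta> * u \<theta> powr q \<partial>lborel)"
    using set_borel_integral_eq_integral(2)[OF ui] by (simp add: set_lebesgue_integral_def)
  also have "\<dots> = (\<integral>\<^sup>+\<theta>. ennreal (?I \<theta> * u \<theta> powr q) \<partial>lborel)"
    using ui by (intro nn_integral_eq_integral[symmetric]) (auto simp: set_integrable_def)
  also have "\<dots> \<le> (\<integral>\<^sup>+\<theta>. \<integral>\<^sup>+t. ennreal (?I \<theta> * (c powr q * (?P \<theta> t * gq t))) \<partial>lborel \<partial>lborel)"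
  proof (rule nn_integral_mono)
    fix \<theta>
    show "ennreal (?I \<theta> * u \<theta> powr q) \<le> (\<integral>\<^sup>+t. ennreal (?I \<theta> * (c powr q * (?P \<theta> t * gq t))) \<partial>lborel)"
    proof (cases "\<theta> \<in> {0..2*pi}")
      case True
      have "set_integrable lborel {0..2*pi} (\<lambda>t. c powr q * (?P \<theta> t * cmod (G t) powr q))"
        using set_integrable_poisson_kernel_mult[OF s Gq, of \<theta>] by simp
      then have "integrable lborel (\<lambda>t. c powr q * (?P \<theta> t * gq t))"
        unfolding set_integrable_def gq_def by (simp add: mult_ac)
      then have "(\<integral>\<^sup>+t. ennreal (c powr q * (?P \<theta> t * gq t)) \<partial>lborel) = ennreal (\<integral>t. c powr q * (?P \<theta> t * gq t) \<partial>lborel)"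
        using P0 gq0 by (intro nn_integral_eq_integral) auto
      then show ?thesis using True pw by (simp add: ennreal_leI)
    qed simp
  qed
  also have "\<dots> = (\<integral>\<^sup>+t. \<integral>\<^sup>+\<theta>. ennreal (?I \<theta> * (c powr q * (?P \<theta> t * gq t))) \<partial>lborel \<partial>lborel)"
  proof -
    have [measurable]: "gq \<in> borel_measurable borel" using gq by simp
    show ?thesis
    proof (rule lborel_pair.Fubini'[symmetric])
      show "(\<lambda>(\<theta>, t). ennreal (?I \<theta> * (c powr q * (?P \<theta> t * gq t)))) \<in> borel_measurable (lborel \<Otimes>\<^sub>M lborel)"
        unfolding poisson_kernel_def by measurable
    qed
  qed
  also have "\<dots> = (\<integral>\<^sup>+t. ennreal (c powr q * gq t) \<partial>lborel)"
  proof (rule nn_integral_cong)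
    fix t
    have k: "set_integrable lborel {0..2*pi} (\<lambda>\<theta>. ?P \<theta> t)"
      using s by (intro borel_integrable_atLeastAtMost' continuous_intros)
    have "(\<integral>\<^sup>+\<theta>. ennreal (?I \<theta> * (c powr q * (?P \<theta> t * gq t))) \<partial>lborel)
        = (\<integral>\<^sup>+\<theta>. ennreal ((c powr q * gq t) * (?I \<theta> * ?P \<theta> t)) \<partial>lborel)"
      by (simp add: mult_ac)
    also have "\<dots> = ennreal (\<integral>\<theta>. (c powr q * gq t) * (?I \<theta> * ?P \<theta> t) \<partial>lborel)"
      using k P0 gq0 by (intro nn_integral_eq_integral integrable_mult_right) (auto simp: set_integrable_def)
    also have "(\<integral>\<theta>. (c powr q * gq t) * (?I \<theta> * ?P \<theta> t) \<partial>lborel) = c powr q * gq t * integral {0..2*pi} (\<lambda>\<theta>. ?P \<theta> t)"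
      using set_borel_integral_eq_integral(2)[OF k] by (simp add: set_lebesgue_integral_def)
    also have "integral {0..2*pi} (\<lambda>\<theta>. ?P \<theta> t) = 1"
      using has_integral_poisson_kernel[OF s] by (rule integral_unique)
    finally show "(\<integral>\<^sup>+\<theta>. ennreal (?I \<theta> * (c powr q * (?P \<theta> t * gq t))) \<partial>lborel) = ennreal (c powr q * gq t)" by simp
  qed
  also have "\<dots> = ennreal (\<integral>t. c powr q * gq t \<partial>lborel)"
    using gq gq0 by (intro nn_integral_eq_integral) auto
  also have "(\<integral>t. c powr q * gq t \<partial>lborel) = c powr q * (LINT t:{0..2*pi}|lborel. cmod (G t) powr q)"
    by (simp add: set_lebesgue_integral_def gq_def)
  finally show ?thesis
    using gq0 by (subst (asm) ennreal_le_iff) (auto simp: set_lebesgue_integral_def)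
qed

section \<open>Lp norms on the circle and integral means\<close>

text \<open>The norm is \<open>real_of_ereal\<close> of an essential supremum, so the latter must be
  shown finite. It is nonnegative because the interval has positive measure, and below infinity by
  membership in the space.\<close>

lemma Lp_norm_infinity_bound:
  assumes "in_Lp \<infinity> G"
  shows "AE t in lborel. t \<in> {0..2*pi} \<longrightarrow> cmod (G t) \<le> Lp_norm \<infinity> G" "0 \<le> Lp_norm \<infinity> G"
proof -
  let ?M = "restrict_space lborel {0..2*pi}"
  define E where "E = esssup ?M (\<lambda>t. ereal (cmod (G t)))"
  have "emeasure ?M (space ?M) = emeasure lborel {0..2*pi}"
    by (simp add: emeasure_restrict_space space_restrict_space)
  then have "emeasure ?M (space ?M) \<noteq> 0" by simp
  then have "0 = esssup ?M (\<lambda>t. 0 :: ereal)" by (rule esssup_const[symmetric])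
  also have "\<dots> \<le> E" unfolding E_def by (rule esssup_mono) auto
  finally have "0 \<le> E" .
  moreover have "E < \<infinity>" using assms by (simp add: in_Lp_def E_def)
  ultimately obtain e where e: "E = ereal e" by (cases E) auto
  have "AE t in ?M. ereal (cmod (G t)) \<le> E" unfolding E_def by (rule esssup_AE)
  then have "AE t in lborel. t \<in> {0..2*pi} \<longrightarrow> ereal (cmod (G t)) \<le> E"
    by (subst (asm) AE_restrict_space_iff) auto
  then show "AE t in lborel. t \<in> {0..2*pi} \<longrightarrow> cmod (G t) \<le> Lp_norm \<infinity> G"
    unfolding Lp_norm_def E_def[symmetric] e by simp
  show "0 \<le> Lp_norm \<infinity> G"
    using \<open>0 \<le> E\<close> unfolding Lp_norm_def E_def[symmetric] e by simp
qed

lemma in_Lp_imp_set_integrable: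
  assumes "1 \<le> p" "in_Lp p G"
  shows "set_integrable lborel {0..2*pi} G"
proof (cases p)
  case (real q)
  then show ?thesis
    using assms by (intro set_integrable_of_powr[of q]) (auto simp: in_Lp_def one_ereal_def)
next
  case PInf
  have "set_integrable lborel {0..2*pi} (\<lambda>t. Lp_norm \<infinity> G)"
    by (intro borel_integrable_atLeastAtMost' continuous_intros)
  then show ?thesis
  proof (rule set_integrable_bound)
    show "set_borel_measurable lborel {0..2*pi} G" using assms by (simp add: in_Lp_def)
    show "AE t in lborel. t \<in> {0..2*pi} \<longrightarrow> norm (G t) \<le> norm (Lp_norm \<infinity> G)"
      using Lp_norm_infinity_bound(1)[of G] assms PInf by (auto elim: eventually_mono)
  qed
qed (use assms in auto)

lemma Lp_norm_nonneg: "in_Lp p G \<Longrightarrow> 0 \<le> Lp_norm p G"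
  using Lp_norm_infinity_bound(2) by (cases "p = \<infinity>") (simp_all add: Lp_norm_def)

text \<open>For finite p this is the Jensen-Tonelli estimate followed by a root; for p infinite, an
  average against a probability density cannot exceed the essential bound. The radii
  \<open>r\<close> and \<open>s\<close> are separate because monotonicity of means uses a quotient
  of radii for \<open>s\<close>, while the final estimate takes both equal.\<close>

lemma int_mean_le_Lp_norm:
  assumes p: "1 \<le> p" and s: "0 \<le> s" "s < 1" and c: "c \<ge> 0" and G: "in_Lp p G"
    and f: "continuous_on {0..2*pi} (\<lambda>\<theta>. f (of_real r * cis \<theta>))"
    and le: "\<And>\<theta>. \<theta> \<in> {0..2*pi} \<Longrightarrow> cmod (f (of_real r * cis \<theta>))
      \<le> c * (LINT t:{0..2*pi}|lborel. poisson_kernel s (t - \<theta>) * cmod (G t))"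
  shows "int_mean p r f \<le> c * Lp_norm p G"
proof (cases p)
  case (real q)
  then have q: "q \<ge> 1" using p by (simp add: one_ereal_def)
  define J where "J = (LINT t:{0..2*pi}|lborel. cmod (G t) powr q)"
  have "integral {0..2*pi} (\<lambda>\<theta>. cmod (f (of_real r * cis \<theta>)) powr q) \<le> c powr q * J"
    unfolding J_def using G real f le
    by (intro poisson_mean_powr_bound[OF q s c]) (auto simp: in_Lp_def intro!: continuous_intros)
  then have "(1 / (2*pi)) * integral {0..2*pi} (\<lambda>\<theta>. cmod (f (of_real r * cis \<theta>)) powr q)
      \<le> c powr q * ((1 / (2*pi)) * J)"
    by (simp add: divide_right_mono)
  moreover have "0 \<le> (1 / (2*pi)) * integral {0..2*pi} (\<lambda>\<theta>. cmod (f (of_real r * cis \<theta>)) powr q)"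
    using q f by (intro mult_nonneg_nonneg integral_nonneg integrable_continuous_real continuous_on_powr'
        continuous_intros) auto
  ultimately have "((1 / (2*pi)) * integral {0..2*pi} (\<lambda>\<theta>. cmod (f (of_real r * cis \<theta>)) powr q)) powr (1/q)
      \<le> (c powr q * ((1 / (2*pi)) * J)) powr (1/q)"
    using q by (intro powr_mono2) auto
  also have "\<dots> = (c powr q) powr (1/q) * ((1 / (2*pi)) * J) powr (1/q)"
    by (rule powr_mult)
  also have "(c powr q) powr (1/q) = c"
    using q c by (simp add: powr_powr)
  finally show ?thesis using real by (simp add: int_mean_def Lp_norm_def J_def)
next
  case PInf
  have "cmod (f (of_real r * cis \<theta>)) \<le> c * Lp_norm \<infinity> G" if \<theta>: "\<theta> \<in> {0..2*pi}" for \<theta>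
  proof -
    have hp: "((\<lambda>t. poisson_kernel s (t - \<theta>)) has_integral 1) {0..2*pi}"
      using has_integral_poisson_kernel[OF s, of \<theta>] by (simp add: poisson_kernel_minus[of s \<theta>])
    have k: "set_integrable lborel {0..2*pi} (\<lambda>t. poisson_kernel s (t - \<theta>))"
      using s by (intro borel_integrable_atLeastAtMost' continuous_intros)
    have kg: "set_integrable lborel {0..2*pi} (\<lambda>t. poisson_kernel s (t - \<theta>) * cmod (G t))"
      using set_integrable_poisson_kernel_mult[OF s set_integrable_norm[OF in_Lp_imp_set_integrable[OF p G]]] by simp
    have "(LINT t:{0..2*pi}|lborel. poisson_kernel s (t - \<theta>) * cmod (G t))
        \<le> (LINT t:{0..2*pi}|lborel. poisson_kernel s (t - \<theta>) * Lp_norm \<infinity> G)"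
    proof (rule set_integral_mono_AE[OF kg])
      show "set_integrable lborel {0..2*pi} (\<lambda>t. poisson_kernel s (t - \<theta>) * Lp_norm \<infinity> G)"
        using k by simp
      have "AE t in lborel. t \<in> {0..2*pi} \<longrightarrow> cmod (G t) \<le> Lp_norm \<infinity> G"
        using Lp_norm_infinity_bound(1) G PInf by blast
      then show "AE t \<in> {0..2*pi} in lborel. poisson_kernel s (t - \<theta>) * cmod (G t)
          \<le> poisson_kernel s (t - \<theta>) * Lp_norm \<infinity> G"
        by (rule eventually_mono) (auto intro!: mult_left_mono poisson_kernel_nonneg s)
    qed
    also have "\<dots> = Lp_norm \<infinity> G"
      using set_borel_integral_eq_integral(2)[OF k] integral_unique[OF hp] by simp
    finally show ?thesis using le[OF \<theta>] c by (meson mult_left_mono order_trans)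
  qed
  then show ?thesis using PInf by (auto simp: int_mean_def intro!: cSUP_least)
qed (use p in auto)

lemma in_Lp_continuous:
  assumes "continuous_on {0..2*pi} G" "1 \<le> p"
  shows "in_Lp p G"
proof -
  have "set_integrable lborel {0..2*pi} G" using assms(1) by (rule borel_integrable_atLeastAtMost')
  then have m: "set_borel_measurable lborel {0..2*pi} G"
    unfolding set_integrable_def set_borel_measurable_def by simp
  show ?thesis
  proof (cases p)
    case (real q)
    then have "set_integrable lborel {0..2*pi} (\<lambda>t. cmod (G t) powr q)"
      using assms by (intro borel_integrable_atLeastAtMost' continuous_on_powr' continuous_intros)
        (auto simp: one_ereal_def)
    then show ?thesis using m real by (simp add: in_Lp_def)
  next
    case PInf
    have "bounded (G ` {0..2*pi})"
      using assms(1) by (intro compact_imp_bounded compact_continuous_image) auto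
    then obtain C where C: "\<And>t. t \<in> {0..2*pi} \<Longrightarrow> cmod (G t) \<le> C" unfolding bounded_iff by blast
    have [measurable]: "G \<in> borel_measurable (restrict_space lborel {0..2*pi})"
      using m by (simp add: set_borel_measurable_def borel_measurable_restrict_space_iff)
    have "esssup (restrict_space lborel {0..2*pi}) (\<lambda>t. ereal (cmod (G t))) \<le> ereal C"
      using C by (intro esssup_I AE_I2) (auto simp: space_restrict_space)
    also have "\<dots> < \<infinity>" by simp
    finally show ?thesis using m PInf by (simp add: in_Lp_def)
  qed (use assms in auto)
qed

text \<open>For finite p the Lebesgue and gauge integrals of a continuous function agree, so both
  sides are equal. For p infinite the essential supremum is at most the supremum.\<close>

lemma Lp_norm_circle_le_int_mean:
  assumes "1 \<le> p" and c: "continuous_on {0..2*pi} (\<lambda>t. f (of_real r * cis t))"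
  shows "Lp_norm p (\<lambda>t. f (of_real r * cis t)) \<le> int_mean p r f"
proof (cases p)
  case (real q)
  then have "continuous_on {0..2*pi} (\<lambda>t. cmod (f (of_real r * cis t)) powr q)"
    using assms by (intro continuous_on_powr' continuous_intros) (auto simp: one_ereal_def)
  then have "set_integrable lborel {0..2*pi} (\<lambda>t. cmod (f (of_real r * cis t)) powr q)"
    by (rule borel_integrable_atLeastAtMost')
  then show ?thesis using real
    by (simp add: Lp_norm_def int_mean_def set_borel_integral_eq_integral(2))
next
  case PInf
  define G where "G t = f (of_real r * cis t)" for t
  have cG: "continuous_on {0..2*pi} G" using c unfolding G_def .
  have "in_Lp p G" using cG assms(1) by (rule in_Lp_continuous)
  then have [measurable]: "G \<in> borel_measurable (restrict_space lborel {0..2*pi})"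
    by (simp add: in_Lp_def set_borel_measurable_def borel_measurable_restrict_space_iff)
  have "bounded (G ` {0..2*pi})"
    using cG by (intro compact_imp_bounded compact_continuous_image) auto
  then have b: "bdd_above ((\<lambda>t. cmod (G t)) ` {0..2*pi})"
    by (auto simp: bounded_iff bdd_above_def)
  define S where "S = (SUP t\<in>{0..2*pi}. cmod (G t))"
  have S: "cmod (G t) \<le> S" if "t \<in> {0..2*pi}" for t
    unfolding S_def using b that by (rule cSUP_upper2) auto
  \<comment> \<open>\<open>real_of_ereal\<close> sends minus infinity to 0, so nonnegativity of
    \<open>S\<close> settles that case below.\<close>
  have "S \<ge> 0" using order_trans[OF norm_ge_zero S[of 0]] by simp
  have "esssup (restrict_space lborel {0..2*pi}) (\<lambda>t. ereal (cmod (G t))) \<le> ereal S"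
    using S by (intro esssup_I AE_I2) (auto simp: space_restrict_space)
  then have "real_of_ereal (esssup (restrict_space lborel {0..2*pi}) (\<lambda>t. ereal (cmod (G t)))) \<le> S"
    using \<open>S \<ge> 0\<close> by (cases "esssup (restrict_space lborel {0..2*pi}) (\<lambda>t. ereal (cmod (G t)))") auto
  then show ?thesis using PInf by (simp add: Lp_norm_def int_mean_def S_def G_def)
qed (use assms in auto)

section \<open>Monotonicity of integral means and the Hardy norm\<close>

lemma continuous_on_circle:
  assumes "continuous_on (ball 0 1) f" "0 \<le> r" "r < 1"
  shows "continuous_on A (\<lambda>\<theta>. f (of_real r * cis \<theta>))"
  using assms by (intro continuous_on_compose2[OF assms(1)] continuous_intros) (auto simp: norm_mult)

text \<open>The dilation of \<open>f\<close> by \<rho> is holomorphic in the unit disc and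
  continuous on its closure. The Poisson formula at radius r/\<rho> < 1 writes the values of
  \<open>f\<close> on the circle of radius \<open>r\<close> as averages of those on the circle of
  radius \<rho>, and averaging contracts.\<close>

lemma int_mean_mono:
  assumes p: "1 \<le> p" and hol: "f holomorphic_on ball 0 1" and r: "0 < r" "r \<le> \<rho>" "\<rho> < 1"
  shows "int_mean p r f \<le> int_mean p \<rho> f"
proof (cases "r = \<rho>")
  case False
  define s where "s = r / \<rho>"
  have s: "0 \<le> s" "s < 1" using r False by (auto simp: s_def)
  have cf: "continuous_on (ball 0 1) f" using hol by (rule holomorphic_on_imp_continuous_on)
  have c: "continuous_on A (\<lambda>\<theta>. f (of_real r * cis \<theta>))" "continuous_on A (\<lambda>\<theta>. f (of_real \<rho> * cis \<theta>))" for A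
    using r cf by (auto intro!: continuous_on_circle)
  have sub: "(\<lambda>u. of_real \<rho> * u) ` cball 0 1 \<subseteq> ball (0::complex) 1"
  proof -
    have "\<rho> * cmod u < 1" if "cmod u \<le> 1" for u
    proof -
      have "\<rho> * cmod u \<le> \<rho>" using that r by (intro mult_left_le) auto
      then show ?thesis using r by linarith
    qed
    then show ?thesis using r by (auto simp: norm_mult)
  qed
  have "int_mean p r f \<le> 1 * Lp_norm p (\<lambda>t. f (of_real \<rho> * cis t))"
  proof (rule int_mean_le_Lp_norm[OF p s _ in_Lp_continuous[OF c(2) p] c(1)])
    fix \<theta> :: real
    have "(\<lambda>u. f (of_real \<rho> * u)) holomorphic_on ball 0 1"
      using hol sub ball_subset_cball
      by (intro holomorphic_on_compose_gen[OF _ hol, unfolded o_def] holomorphic_intros) blast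
    moreover have "continuous_on (cball 0 1) (\<lambda>u. f (of_real \<rho> * u))"
      using sub by (intro continuous_on_compose2[OF cf] continuous_intros) auto
    ultimately have "((\<lambda>t. of_real (poisson_kernel s (t - \<theta>)) * f (of_real \<rho> * cis t)) has_integral
        f (of_real \<rho> * (of_real s * cis \<theta>))) {0..2*pi}"
      using poisson_formula_holomorphic[of "\<lambda>u. f (of_real \<rho> * u)" "of_real s * cis \<theta>"] s
      by (simp add: poisson_kernel_Arg_polar norm_mult)
    moreover have "of_real \<rho> * (of_real s * cis \<theta>) = of_real r * cis \<theta>"
      using r by (simp add: s_def)
    moreover have i: "set_integrable lborel {0..2*pi} (\<lambda>t. of_real (poisson_kernel s (t - \<theta>)) * f (of_real \<rho> * cis t))"
      using s c(2) by (intro borel_integrable_atLeastAtMost' continuous_intros)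
    ultimately have "f (of_real r * cis \<theta>) = (LINT t:{0..2*pi}|lborel. of_real (poisson_kernel s (t - \<theta>)) * f (of_real \<rho> * cis t))"
      using set_borel_integral_eq_integral(2)[OF i] by (simp add: integral_unique)
    also have "cmod \<dots> \<le> (LINT t:{0..2*pi}|lborel. cmod (of_real (poisson_kernel s (t - \<theta>)) * f (of_real \<rho> * cis t)))"
      using i by (rule set_integral_norm_bound)
    finally show "cmod (f (of_real r * cis \<theta>))
        \<le> 1 * (LINT t:{0..2*pi}|lborel. poisson_kernel s (t - \<theta>) * cmod (f (of_real \<rho> * cis t)))"
      using poisson_kernel_nonneg[OF s] by (simp add: norm_mult)
  qed simp
  also have "\<dots> \<le> int_mean p \<rho> f"
    using Lp_norm_circle_le_int_mean[OF p c(2)] by simp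
  finally show ?thesis .
qed simp

text \<open>Monotone means converge at 1 to their supremum, so the limit defining the Hardy norm
  exists, and B/r tends to B.\<close>

lemma in_Hardy_and_norm_le:
  assumes p: "1 \<le> p" and hol: "f holomorphic_on ball 0 1"
    and le: "\<And>r. \<lbrakk>0 < r; r < 1\<rbrakk> \<Longrightarrow> int_mean p r f \<le> B / r"
  shows "in_Hardy p f" "Hardy_norm p f \<le> B"
proof -
  let ?M = "\<lambda>r. int_mean p r f"
  \<comment> \<open>The bound B/r is useless near 0, so radii up to 1/2 are compared with 1/2 by
    monotonicity. Beyond 1/2, B/r is at most 2B if B \<ge> 0 and at most 0 otherwise.\<close>
  have "?M r \<le> max (?M (1/2)) (max (2 * B) 0)" if "r \<in> {0<..<1}" for r
  proof (cases "r \<le> 1/2")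
    case True
    then show ?thesis using int_mean_mono[OF p hol, of r "1/2"] that by (simp add: le_max_iff_disj)
  next
    case False
    have "B / r \<le> max (2 * B) 0"
    proof (cases "B \<ge> 0")
      case True
      then show ?thesis using False that mult_left_mono[of 1 "2 * r" B]
        by (simp add: pos_divide_le_eq le_max_iff_disj mult_ac)
    next
      case B: False
      then have "B / r \<le> 0" using that by (simp add: divide_nonpos_pos)
      then show ?thesis by simp
    qed
    then show ?thesis using le[of r] that by auto
  qed
  then have bdd: "bdd_above (?M ` {0<..<1})" by (intro bdd_aboveI2)
  show "in_Hardy p f" using hol bdd by (simp add: in_Hardy_def)
  define L where "L = (SUP r\<in>{0<..<1}. ?M r)"
  have lim: "(?M \<longlongrightarrow> L) (at_left 1)"
  proof (rule order_tendstoI)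
    fix a assume "a < L"
    then obtain r where r: "r \<in> {0<..<1}" "a < ?M r"
      unfolding L_def using less_cSUP_iff[OF _ bdd] by auto
    have "\<forall>y>r. y < 1 \<longrightarrow> a < ?M y"
      using r int_mean_mono[OF p hol, of r] by (auto intro: less_le_trans)
    then show "\<forall>\<^sub>F r in at_left 1. a < ?M r"
      using r by (auto simp: eventually_at_left_field)
  next
    fix a assume "L < a"
    have "?M r \<le> L" if "r \<in> {0<..<1}" for r
      unfolding L_def using that bdd by (rule cSUP_upper)
    then have "\<forall>y>0. y < 1 \<longrightarrow> ?M y < a" using \<open>L < a\<close> by (auto intro: le_less_trans)
    then show "\<forall>\<^sub>F r in at_left 1. ?M r < a"
      by (auto simp: eventually_at_left_field intro!: exI[of _ 0])
  qed
  then have "Hardy_norm p f = L"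
    unfolding Hardy_norm_def by (intro tendsto_Lim) auto
  also have "L \<le> B"
  proof (rule tendsto_le[OF _ _ lim])
    have "((\<lambda>r. B / r) \<longlongrightarrow> B / 1) (at_left 1)" by (intro tendsto_intros) auto
    then show "((\<lambda>r. B / r) \<longlongrightarrow> B) (at_left 1)" by simp
    show "\<forall>\<^sub>F r in at_left 1. ?M r \<le> B / r"
      using le by (auto simp: eventually_at_left_field intro!: exI[of _ 0])
  qed auto
  finally show "Hardy_norm p f \<le> B" .
qed

section \<open>Derivatives of the Poisson integral\<close>

text \<open>The z-derivative of the Schwarz-type integral of \<psi> with kernel z / (cis t - z),
  without the factor 1/(2 pi).\<close>

definition schwarz_deriv :: "(real \<Rightarrow> complex) \<Rightarrow> complex \<Rightarrow> complex" where
  "schwarz_deriv \<psi> z = integral {0..2*pi} (\<lambda>t. \<psi> t * (cis t / (cis t - z)\<^sup>2))"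

lemma schwarz_has_field_derivative:
  assumes \<psi>: "continuous_on {0..2*pi} \<psi>" and z: "cmod z < 1"
  shows "((\<lambda>z. integral {0..2*pi} (\<lambda>t. \<psi> t * (z / (cis t - z)))) has_field_derivative schwarz_deriv \<psi> z) (at z)"
proof -
  have ne: "cis t - z \<noteq> 0" if "z \<in> ball 0 1" for t z
    using that cis_neq[of z t] by simp
  have "((\<lambda>z. integral (cbox 0 (2*pi)) (\<lambda>t. \<psi> t * (z / (cis t - z)))) has_field_derivative
      integral (cbox 0 (2*pi)) (\<lambda>t. \<psi> t * (cis t / (cis t - z)\<^sup>2))) (at z within ball 0 1)"
  proof (rule leibniz_rule_field_derivative)
    fix x :: complex and t :: real assume x: "x \<in> ball 0 1"
    show "((\<lambda>x. \<psi> t * (x / (cis t - x))) has_field_derivative \<psi> t * (cis t / (cis t - x)\<^sup>2)) (at x within ball 0 1)"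
      using ne[OF x, of t]
      by (auto intro!: derivative_eq_intros simp: power2_eq_square field_simps)
  next
    fix x :: complex assume x: "x \<in> ball 0 1"
    show "(\<lambda>t. \<psi> t * (x / (cis t - x))) integrable_on cbox 0 (2*pi)"
      using ne[OF x] \<psi> by (intro integrable_continuous continuous_intros) auto
  next
    show "continuous_on (ball 0 1 \<times> cbox 0 (2*pi)) (\<lambda>(x, t). \<psi> t * (cis t / (cis t - x)\<^sup>2))"
      unfolding case_prod_unfold using ne
      by (intro continuous_intros continuous_on_compose2[OF \<psi>]) auto
  qed (use z in auto)
  then show ?thesis
    unfolding schwarz_deriv_def using z by (simp add: at_within_open[OF _ open_ball])
qed

text \<open>The function is the complex derivative of a holomorphic function on the disc.\<close>

lemma holomorphic_on_schwarz_deriv: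
  assumes "continuous_on {0..2*pi} \<psi>"
  shows "schwarz_deriv \<psi> holomorphic_on ball 0 1"
proof -
  let ?C = "\<lambda>z. integral {0..2*pi} (\<lambda>t. \<psi> t * (z / (cis t - z)))"
  have d: "(?C has_field_derivative schwarz_deriv \<psi> z) (at z)" if "z \<in> ball 0 1" for z
    using schwarz_has_field_derivative[OF assms] that by simp
  then have "?C holomorphic_on ball 0 1"
    unfolding holomorphic_on_open[OF open_ball] by blast
  then have "deriv ?C holomorphic_on ball 0 1" by (intro holomorphic_deriv) auto
  then show ?thesis
    by (rule holomorphic_transform) (use d DERIV_imp_deriv in blast)
qed

text \<open>Up to 2 pi the kernel is the real part of (cis t + z) / (cis t - z), here split into a
  constant, a part holomorphic in z and its conjugate.\<close>

lemma of_real_poisson_kernel: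
  assumes "cmod z < 1"
  shows "of_real (poisson_kernel (cmod z) (t - Arg z))
    = (1 + z / (cis t - z) + cnj (z / (cis t - z))) / (2 * of_real pi)"
proof -
  have d: "cis t - z \<noteq> 0" using cis_neq[OF assms] by simp
  then have d': "cnj (cis t) - cnj z \<noteq> 0" by (metis complex_cnj_diff complex_cnj_zero_iff)
  have 1: "cis t * cnj (cis t) = 1" by (simp add: cis_cnj cis_mult)
  have zz: "of_real ((cmod z)\<^sup>2) = z * cnj z"
    by (metis complex_norm_square of_real_power)
  have "of_real ((cmod (cis t - z))\<^sup>2) = (cis t - z) * (cnj (cis t) - cnj z)"
    by (metis complex_norm_square complex_cnj_diff of_real_power)
  then have "of_real (poisson_kernel (cmod z) (t - Arg z))
      = (1 - z * cnj z) / ((cis t - z) * (cnj (cis t) - cnj z)) / (2 * of_real pi)"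
    unfolding poisson_kernel_cmod_Arg zz[symmetric] by simp
  \<comment> \<open>The numerator is expanded in the two factors of the denominator, using that
    \<open>cis t\<close> has modulus 1.\<close>
  also have "1 - z * cnj z = (cis t - z) * (cnj (cis t) - cnj z) + z * (cnj (cis t) - cnj z) + cnj z * (cis t - z)"
    using 1 by algebra
  also have "\<dots> / ((cis t - z) * (cnj (cis t) - cnj z)) = 1 + z / (cis t - z) + cnj z / (cnj (cis t) - cnj z)"
    using d d' by (simp add: add_divide_distrib)
  finally show ?thesis by simp
qed

text \<open>The split of the kernel is integrated against the boundary function. Conjugating the
  boundary values turns the antiholomorphic part into the conjugate of an integral of the same
  holomorphic shape.\<close>

lemma poisson_integral_decomposition:
  assumes \<phi>: "continuous_on {0..2*pi} (\<lambda>t. F (cis t))" and z: "cmod z < 1"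
  shows "poisson_integral F z = (integral {0..2*pi} (\<lambda>t. F (cis t))
      + integral {0..2*pi} (\<lambda>t. F (cis t) * (z / (cis t - z)))
      + cnj (integral {0..2*pi} (\<lambda>t. cnj (F (cis t)) * (z / (cis t - z))))) / (2 * of_real pi)"
proof -
  have ne: "cis t - z \<noteq> 0" for t using cis_neq[OF z] by simp
  then have nec: "cnj (cis t) - cnj z \<noteq> 0" for t by (metis complex_cnj_diff complex_cnj_zero_iff)
  have i: "(\<lambda>t. F (cis t)) integrable_on {0..2*pi}"
    "(\<lambda>t. F (cis t) * (z / (cis t - z))) integrable_on {0..2*pi}"
    "(\<lambda>t. F (cis t) * cnj (z / (cis t - z))) integrable_on {0..2*pi}"
    using \<phi> ne by (intro integrable_continuous_real continuous_intros; simp)+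
  have "poisson_integral F z = integral {0..2*pi} (\<lambda>t.
      (F (cis t) + F (cis t) * (z / (cis t - z)) + F (cis t) * cnj (z / (cis t - z))) / (2 * of_real pi))"
    unfolding poisson_integral_def of_real_poisson_kernel[OF z]
    by (intro integral_cong) (simp add: field_simps)
  also have "\<dots> = integral {0..2*pi} (\<lambda>t.
      (F (cis t) + F (cis t) * (z / (cis t - z)) + F (cis t) * cnj (z / (cis t - z)))) / (2 * of_real pi)"
    by (rule integral_divide)
  also have "integral {0..2*pi} (\<lambda>t.
      (F (cis t) + F (cis t) * (z / (cis t - z)) + F (cis t) * cnj (z / (cis t - z))))
      = integral {0..2*pi} (\<lambda>t. F (cis t)) + integral {0..2*pi} (\<lambda>t. F (cis t) * (z / (cis t - z)))
      + integral {0..2*pi} (\<lambda>t. F (cis t) * cnj (z / (cis t - z)))"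
    using i by (simp add: integral_add integrable_add)
  also have "integral {0..2*pi} (\<lambda>t. F (cis t) * cnj (z / (cis t - z)))
      = cnj (integral {0..2*pi} (\<lambda>t. cnj (F (cis t)) * (z / (cis t - z))))"
    by (simp add: integral_cnj)
  finally show ?thesis .
qed

text \<open>Up to the factor 1/(2 pi), the derivative of the decomposition maps \<open>d\<close> to
  \<open>a * d + cnj (b * d)\<close>; evaluation at 1 and \<i> separates \<open>a\<close> from
  \<open>cnj b\<close>.\<close>

lemma wirtinger_poisson_integral:
  assumes \<phi>: "continuous_on {0..2*pi} (\<lambda>t. F (cis t))" and z: "cmod z < 1"
  shows "wirt_z (poisson_integral F) z = schwarz_deriv (\<lambda>t. F (cis t)) z / (2 * of_real pi)"
    and "wirt_zbar (poisson_integral F) z = cnj (schwarz_deriv (\<lambda>t. cnj (F (cis t))) z) / (2 * of_real pi)"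
proof -
  define a where "a = schwarz_deriv (\<lambda>t. F (cis t)) z"
  define b where "b = schwarz_deriv (\<lambda>t. cnj (F (cis t))) z"
  define g where "g z = integral {0..2*pi} (\<lambda>t. F (cis t) * (z / (cis t - z)))" for z
  define h where "h z = integral {0..2*pi} (\<lambda>t. cnj (F (cis t)) * (z / (cis t - z)))" for z
  define c where "c = integral {0..2*pi} (\<lambda>t. F (cis t))"
  have "(g has_field_derivative a) (at z)" "(h has_field_derivative b) (at z)"
    unfolding g_def h_def a_def b_def
    using \<phi> z by (intro schwarz_has_field_derivative continuous_intros; simp)+
  then have gh: "(g has_derivative (\<lambda>d. a * d)) (at z)" "(h has_derivative (\<lambda>d. b * d)) (at z)"
    by (simp_all add: has_field_derivative_def)
  have "((\<lambda>z. c + g z + cnj (h z)) has_derivative (\<lambda>d. 0 + a * d + cnj (b * d))) (at z)"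
    by (intro has_derivative_add has_derivative_const gh(1) bounded_linear.has_derivative[OF bounded_linear_cnj gh(2)])
  then have "((\<lambda>z. (c + g z + cnj (h z)) / (2 * of_real pi)) has_derivative
      (\<lambda>d. (0 + a * d + cnj (b * d)) / (2 * of_real pi))) (at z)"
    by (rule bounded_linear.has_derivative[OF bounded_linear_divide])
  then have "((\<lambda>z. (c + g z + cnj (h z)) / (2 * of_real pi)) has_derivative
      (\<lambda>d. (a * d + cnj (b * d)) / (2 * of_real pi))) (at z)" by simp
  then have "(poisson_integral F has_derivative (\<lambda>d. (a * d + cnj (b * d)) / (2 * of_real pi))) (at z)"
  proof (rule has_derivative_transform_within_open)
    show "(c + g x + cnj (h x)) / (2 * of_real pi) = poisson_integral F x" if "x \<in> ball 0 1" for x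
      using poisson_integral_decomposition[OF \<phi>, of x] that by (simp add: c_def g_def h_def)
  qed (use z in auto)
  then have "frechet_derivative (poisson_integral F) (at z) = (\<lambda>d. (a * d + cnj (b * d)) / (2 * of_real pi))"
    by (rule frechet_derivative_at[symmetric])
  then show "wirt_z (poisson_integral F) z = a / (2 * of_real pi)"
    and "wirt_zbar (poisson_integral F) z = cnj b / (2 * of_real pi)"
    unfolding wirt_z_def wirt_zbar_def by (simp_all add: field_simps)
qed

text \<open>The left side is the angular derivative of \<open>P[F]\<close>.\<close>
lemma angular_derivative_poisson_integral:
  assumes ac: "abs_continuous_on 0 (2*pi) (\<lambda>t. F (cis t))"
    and Fdot: "AE t in lborel. t \<in> {0..2*pi} \<longrightarrow> ((\<lambda>s. F (cis s)) has_vector_derivative Fdot t) (at t)"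
    and z: "cmod z < 1"
  shows "((\<lambda>t. of_real (poisson_kernel (cmod z) (t - Arg z)) * Fdot t) has_integral
      \<i> * (z * wirt_z (poisson_integral F) z - cnj z * wirt_zbar (poisson_integral F) z)) {0..2*pi}"
proof -
  let ?I = "{0..2*pi}"
  define K where "K t = (1 + z / (cis t - z) + cnj (z / (cis t - z))) / (2 * of_real pi)" for t
  define q where "q t = cis t / (cis t - z)\<^sup>2" for t
  \<comment> \<open>The t-derivative of the kernel: differentiating z / (cis t - z) in t gives -\<i>
    z \<open>q t\<close>, where \<open>q\<close> is the weight occurring in
    \<open>schwarz_deriv\<close>.\<close>
  define K' where "K' t = (- (\<i> * z * q t) + cnj (- (\<i> * z * q t))) / (2 * of_real pi)" for t
  have K: "of_real (poisson_kernel (cmod z) (t - Arg z)) = K t" for t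
    unfolding K_def by (rule of_real_poisson_kernel[OF z])
  have ne: "cis t - z \<noteq> 0" for t using cis_neq[OF z] by simp
  have cq: "continuous_on A q" for A unfolding q_def using ne by (intro continuous_intros) auto
  have \<phi>: "continuous_on ?I (\<lambda>t. F (cis t))" using ac by (rule abs_continuous_on_imp_continuous_on)
  have cis': "(cis has_vector_derivative \<i> * cis t) (at t within A)" for t A
    using has_derivative_cis[OF has_derivative_ident] by (simp add: has_vector_derivative_def)
  have B: "((\<lambda>t. z / (cis t - z)) has_vector_derivative - (\<i> * z * q t)) (at t within A)" for t A
    unfolding has_vector_derivative_def q_def using ne[of t]
    by (auto intro!: derivative_eq_intros ext simp: field_simps power2_eq_square scaleR_conv_of_real)
  have dK: "(K has_vector_derivative K' t) (at t within A)" for t A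
    using has_vector_derivative_divide[OF has_vector_derivative_add[OF
        has_vector_derivative_add[OF has_vector_derivative_const[of 1] B] has_vector_derivative_cnj[OF B]]]
    unfolding K_def K'_def by simp
  have cK': "continuous_on A K'" for A
    unfolding K'_def using cq by (intro continuous_intros) auto
  have "bounded (K' ` ?I)"
    using cK' by (intro compact_imp_bounded compact_continuous_image) auto
  then obtain L where L: "L > 0" "\<And>t. t \<in> ?I \<Longrightarrow> norm (K' t) \<le> L" unfolding bounded_pos by blast
  \<comment> \<open>A bounded derivative makes the kernel Lipschitz, so its product with the
    boundary function stays absolutely continuous.\<close>
  have "L-lipschitz_on ?I K"
  proof (rule bounded_derivative_imp_lipschitz)
    show "(K has_derivative (\<lambda>h. h *\<^sub>R K' t)) (at t within ?I)" for t
      using dK by (simp add: has_vector_derivative_def)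
    show "onorm (\<lambda>h. h *\<^sub>R K' t) \<le> L" if "t \<in> ?I" for t
    proof (rule onorm_le)
      fix h :: real
      have "\<bar>h\<bar> * norm (K' t) \<le> \<bar>h\<bar> * L" using L(2)[OF that] by (intro mult_left_mono) auto
      then show "norm (h *\<^sub>R K' t) \<le> L * norm h" by (simp add: mult.commute)
    qed
  qed (use L in auto)
  with ac have acK: "abs_continuous_on 0 (2*pi) (\<lambda>t. F (cis t) * K t)"
    by (rule abs_continuous_on_mult_lipschitz)
  obtain N where N: "N \<in> null_sets lborel" "{t \<in> space lborel. \<not> (t \<in> ?I \<longrightarrow>
      ((\<lambda>s. F (cis s)) has_vector_derivative Fdot t) (at t))} \<subseteq> N"
    using Fdot unfolding eventually_ae_filter by (elim bexE)
  have "negligible N" using N(1) by (simp add: negligible_iff_null_sets null_sets_completionI)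
  have total: "((\<lambda>t. F (cis t) * K' t + Fdot t * K t) has_integral F (cis (2*pi)) * K (2*pi) - F (cis 0) * K 0) ?I"
  proof (rule abs_continuous_fundamental_theorem_of_calculus[OF _ acK \<open>negligible N\<close>])
    fix t assume t: "t \<in> ?I - N"
    then have "((\<lambda>s. F (cis s)) has_vector_derivative Fdot t) (at t within ?I)"
      using N(2) by (auto intro: has_vector_derivative_at_within)
    then show "((\<lambda>t. F (cis t) * K t) has_vector_derivative F (cis t) * K' t + Fdot t * K t) (at t within ?I)"
      using dK by (rule has_vector_derivative_mult)
  qed simp
  \<comment> \<open>The boundary terms cancel because \<open>cis\<close> takes the value 1 at both
    ends.\<close>
  have period: "F (cis (2*pi)) * K (2*pi) - F (cis 0) * K 0 = 0" by (simp add: K_def)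
  have "((\<lambda>t. F (cis t) * K' t) has_integral
      (- (\<i> * z) * schwarz_deriv (\<lambda>t. F (cis t)) z + cnj (- (\<i> * z) * schwarz_deriv (\<lambda>t. cnj (F (cis t))) z)) / (2 * of_real pi)) ?I"
  proof -
    have 1: "((\<lambda>t. F (cis t) * q t) has_integral schwarz_deriv (\<lambda>t. F (cis t)) z) ?I"
      "((\<lambda>t. cnj (F (cis t)) * q t) has_integral schwarz_deriv (\<lambda>t. cnj (F (cis t))) z) ?I"
      unfolding schwarz_deriv_def q_def[symmetric] using \<phi> cq
      by (intro integrable_integral integrable_continuous_real continuous_intros; simp)+
    have 2: "((\<lambda>t. cnj (- (\<i> * z) * (cnj (F (cis t)) * q t))) has_integral
        cnj (- (\<i> * z) * schwarz_deriv (\<lambda>t. cnj (F (cis t))) z)) ?I"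
      using has_integral_linear[OF has_integral_mult_right[OF 1(2), of "- (\<i> * z)"] bounded_linear_cnj]
      by (simp only: o_def)
    have "((\<lambda>t. (- (\<i> * z) * (F (cis t) * q t) + cnj (- (\<i> * z) * (cnj (F (cis t)) * q t))) / (2 * of_real pi)) has_integral
      (- (\<i> * z) * schwarz_deriv (\<lambda>t. F (cis t)) z + cnj (- (\<i> * z) * schwarz_deriv (\<lambda>t. cnj (F (cis t))) z)) / (2 * of_real pi)) ?I"
      by (intro has_integral_divide has_integral_add has_integral_mult_right 1 2)
    then show ?thesis
      by (rule has_integral_eq[rotated]) (simp add: K'_def field_simps)
  qed
  \<comment> \<open>Integration by parts: the integral of \<open>Fdot\<close> against the kernel is
    minus that of the boundary function against \<open>K'\<close>, and the latter is expressed
    through the two Wirtinger derivatives.\<close>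
  from has_integral_diff[OF total[unfolded period] this] show ?thesis
    unfolding K wirtinger_poisson_integral[OF \<phi> z]
    by (simp add: mult.commute diff_divide_distrib add_divide_distrib algebra_simps)
qed

section \<open>Quasiregularity\<close>

text \<open>The infimum is attained because at each point the condition on K is a closed one: where
  the Jacobian term \<open>d\<close> is positive it is a lower bound on K, and where
  \<open>d\<close> vanishes the left side \<open>l\<close> must be 0 as well.\<close>

lemma qr_bound_outer_dilatation:
  assumes "harmonic_quasiregular w"
  shows "qr_bound w (outer_dilatation w)"
proof -
  let ?S = "{K. qr_bound w K}"
  have ne: "?S \<noteq> {}" using assms by (auto simp: harmonic_quasiregular_def)
  have ge: "1 \<le> K" if "K \<in> ?S" for K using that by (simp add: qr_bound_def)
  have "1 \<le> Inf ?S" using ne ge by (rule cInf_greatest)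
  moreover have "(cmod (wirt_z w z) + cmod (wirt_zbar w z))\<^sup>2
      \<le> Inf ?S * ((cmod (wirt_z w z))\<^sup>2 - (cmod (wirt_zbar w z))\<^sup>2)" if z: "z \<in> ball 0 1" for z
  proof -
    define l where "l = (cmod (wirt_z w z) + cmod (wirt_zbar w z))\<^sup>2"
    define d where "d = (cmod (wirt_z w z))\<^sup>2 - (cmod (wirt_zbar w z))\<^sup>2"
    have l: "l \<le> K * d" if "K \<in> ?S" for K
      using that z by (simp add: qr_bound_def l_def d_def)
    obtain K where K: "K \<in> ?S" using ne by blast
    have "0 \<le> l" by (simp add: l_def)
    then have "0 \<le> K * d" using l[OF K] by linarith
    then have "0 \<le> d" using ge[OF K] by (simp add: zero_le_mult_iff)
    have "l \<le> Inf ?S * d"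
    proof (cases "d = 0")
      case True
      then show ?thesis using l[OF K] by simp
    next
      case False
      then have d: "d > 0" using \<open>0 \<le> d\<close> by simp
      have "l / d \<le> Inf ?S"
        using l d by (intro cInf_greatest[OF ne]) (simp add: pos_divide_le_eq)
      then show ?thesis using d by (simp add: pos_divide_le_eq)
    qed
    then show ?thesis by (simp only: l_def d_def)
  qed
  ultimately show ?thesis by (simp add: qr_bound_def outer_dilatation_def)
qed

text \<open>Cancelling \<open>a + b\<close> leaves \<open>a + b \<le> K * (a - b)\<close>; adding or
  subtracting \<open>a - b\<close> then gives the two bounds.\<close>

lemma quasiregular_split:
  fixes a b K :: real
  assumes "0 \<le> a" "0 \<le> b" and qr: "(a + b)\<^sup>2 \<le> K * (a\<^sup>2 - b\<^sup>2)"
  shows "a \<le> (K + 1) / 2 * (a - b)" "b \<le> (K - 1) / 2 * (a - b)"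
proof -
  have "a + b \<le> K * (a - b)"
  proof (cases "a + b = 0")
    case True
    then show ?thesis using assms by (simp add: add_nonneg_eq_0_iff)
  next
    case False
    then have "a + b > 0" using assms by simp
    moreover have "(a + b) * (a + b) \<le> (a + b) * (K * (a - b))"
      using qr by (simp add: power2_eq_square algebra_simps)
    ultimately show ?thesis by simp
  qed
  then show "a \<le> (K + 1) / 2 * (a - b)" "b \<le> (K - 1) / 2 * (a - b)"
    by (simp_all add: field_simps)
qed

section \<open>Hardy bounds for the Wirtinger derivatives\<close>

theorem theorem1p3:
  fixes p :: ereal and F :: "complex \<Rightarrow> complex" and Fdot :: "real \<Rightarrow> complex" and K :: real
  assumes hp: "1 \<le> p"
    and hac: "abs_continuous_on 0 (2*pi) (\<lambda>t. F (cis t))"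
    and hFdot: "AE t in lborel. t \<in> {0..2*pi} \<longrightarrow>
                  ((\<lambda>s. F (cis s)) has_vector_derivative Fdot t) (at t)"
    and hLp: "in_Lp p Fdot"
    and hqr: "harmonic_quasiregular (poisson_integral F)"
    and hK: "K = outer_dilatation (poisson_integral F)"
  shows "in_Hardy p (wirt_z (poisson_integral F))
       \<and> in_Hardy p (\<lambda>z. cnj (wirt_zbar (poisson_integral F) z))
       \<and> Hardy_norm p (wirt_z (poisson_integral F)) \<le> K * Lp_norm p Fdot
       \<and> Hardy_norm p (\<lambda>z. cnj (wirt_zbar (poisson_integral F) z)) \<le> (K - 1) / 2 * Lp_norm p Fdot"
proof -
  let ?w = "poisson_integral F"
  let ?\<phi> = "\<lambda>t. F (cis t)"
  define L where "L = Lp_norm p Fdot"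
  have "qr_bound ?w K" unfolding hK by (rule qr_bound_outer_dilatation[OF hqr])
  then have K1: "K \<ge> 1" and qr: "\<And>z. z \<in> ball 0 1 \<Longrightarrow>
      (cmod (wirt_z ?w z) + cmod (wirt_zbar ?w z))\<^sup>2 \<le> K * ((cmod (wirt_z ?w z))\<^sup>2 - (cmod (wirt_zbar ?w z))\<^sup>2)"
    by (auto simp: qr_bound_def)
  have \<phi>: "continuous_on {0..2*pi} ?\<phi>" using hac by (rule abs_continuous_on_imp_continuous_on)
  then have \<phi>c: "continuous_on {0..2*pi} (\<lambda>t. cnj (?\<phi> t))" by (intro continuous_intros)
  have hol: "wirt_z ?w holomorphic_on ball 0 1"
  proof (rule holomorphic_transform)
    show "(\<lambda>z. schwarz_deriv ?\<phi> z / (2 * of_real pi)) holomorphic_on ball 0 1"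
      by (intro holomorphic_intros holomorphic_on_schwarz_deriv \<phi>) auto
  qed (simp add: wirtinger_poisson_integral[OF \<phi>])
  have holc: "(\<lambda>z. cnj (wirt_zbar ?w z)) holomorphic_on ball 0 1"
  proof (rule holomorphic_transform)
    show "(\<lambda>z. schwarz_deriv (\<lambda>t. cnj (?\<phi> t)) z / (2 * of_real pi)) holomorphic_on ball 0 1"
      by (intro holomorphic_intros holomorphic_on_schwarz_deriv \<phi>c) auto
  qed (simp add: wirtinger_poisson_integral[OF \<phi>])
  define T where "T r \<theta> = (LINT t:{0..2*pi}|lborel. poisson_kernel r (t - \<theta>) * cmod (Fdot t))" for r \<theta>
  \<comment> \<open>On |z| = r the reverse triangle inequality bounds r times this difference by the
    modulus of the angular derivative, which is at most \<open>T r \<theta>\<close>, the Poisson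
    average of |\<open>Fdot\<close>|.\<close>
  have pw: "cmod (wirt_z ?w (of_real r * cis \<theta>)) - cmod (wirt_zbar ?w (of_real r * cis \<theta>)) \<le> T r \<theta> / r"
    if r: "0 < r" "r < 1" for r \<theta>
  proof -
    define z where "z = of_real r * cis \<theta>"
    have z: "cmod z = r" using r by (simp add: z_def norm_mult)
    have k: "poisson_kernel (cmod z) (t - Arg z) = poisson_kernel r (t - \<theta>)" for t
      using poisson_kernel_Arg_polar[of r t \<theta>] r unfolding z by (simp add: z_def)
    have i: "set_integrable lborel {0..2*pi} (\<lambda>t. of_real (poisson_kernel r (t - \<theta>)) * Fdot t)"
      using set_integrable_poisson_kernel_mult[OF _ _ in_Lp_imp_set_integrable[OF hp hLp], of r \<theta>] r
      by (simp add: scaleR_conv_of_real)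
    have "\<i> * (z * wirt_z ?w z - cnj z * wirt_zbar ?w z)
        = (LINT t:{0..2*pi}|lborel. of_real (poisson_kernel r (t - \<theta>)) * Fdot t)"
      using set_borel_integral_eq_integral(2)[OF i]
        integral_unique[OF angular_derivative_poisson_integral[OF hac hFdot, of z, unfolded k]] r z by simp
    then have "cmod (\<i> * (z * wirt_z ?w z - cnj z * wirt_zbar ?w z)) \<le> T r \<theta>"
      using set_integral_norm_bound[OF i] r poisson_kernel_nonneg[of r] by (simp add: T_def norm_mult)
    moreover have "cmod (\<i> * (z * wirt_z ?w z - cnj z * wirt_zbar ?w z)) \<ge> r * cmod (wirt_z ?w z) - r * cmod (wirt_zbar ?w z)"
      using norm_triangle_ineq2[of "z * wirt_z ?w z" "cnj z * wirt_zbar ?w z"] by (simp add: norm_mult z)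
    ultimately have "r * (cmod (wirt_z ?w z) - cmod (wirt_zbar ?w z)) \<le> T r \<theta>"
      by (simp add: right_diff_distrib)
    then show ?thesis using r unfolding z_def by (simp add: pos_le_divide_eq mult.commute)
  qed
  \<comment> \<open>Shared by both derivatives, with c = (K + 1)/2 for \<open>wirt_z\<close> and c =
    (K - 1)/2 for the conjugate of \<open>wirt_zbar\<close>.\<close>
  have bound: "int_mean p r f \<le> (c * L) / r"
    if r: "0 < r" "r < 1" and c: "c \<ge> 0" and f: "f holomorphic_on ball 0 1"
      and le: "\<And>z. z \<in> ball 0 1 \<Longrightarrow> cmod (f z) \<le> c * (cmod (wirt_z ?w z) - cmod (wirt_zbar ?w z))" for c r f
  proof -
    have "int_mean p r f \<le> (c / r) * Lp_norm p Fdot"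
    proof (rule int_mean_le_Lp_norm[OF hp _ _ _ hLp])
      show "continuous_on {0..2*pi} (\<lambda>\<theta>. f (of_real r * cis \<theta>))"
        using r f by (intro continuous_on_circle holomorphic_on_imp_continuous_on) auto
      show "cmod (f (of_real r * cis \<theta>)) \<le> c / r * (LINT t:{0..2*pi}|lborel. poisson_kernel r (t - \<theta>) * cmod (Fdot t))" for \<theta>
      proof -
        have "cmod (f (of_real r * cis \<theta>)) \<le> c * (cmod (wirt_z ?w (of_real r * cis \<theta>)) - cmod (wirt_zbar ?w (of_real r * cis \<theta>)))"
          using r by (intro le) (simp add: norm_mult)
        also have "\<dots> \<le> c * (T r \<theta> / r)" using pw[OF r] c by (intro mult_left_mono)
        finally show ?thesis by (simp add: T_def)
      qed
    qed (use r c in auto)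
    then show ?thesis by (simp add: L_def)
  qed
  have split: "cmod (wirt_z ?w z) \<le> (K + 1) / 2 * (cmod (wirt_z ?w z) - cmod (wirt_zbar ?w z))"
    "cmod (cnj (wirt_zbar ?w z)) \<le> (K - 1) / 2 * (cmod (wirt_z ?w z) - cmod (wirt_zbar ?w z))" if "z \<in> ball 0 1" for z
    using quasiregular_split[OF _ _ qr[OF that]] by simp_all
  have 1: "in_Hardy p (wirt_z ?w)" "Hardy_norm p (wirt_z ?w) \<le> (K + 1) / 2 * L"
    using in_Hardy_and_norm_le[OF hp hol bound[OF _ _ _ hol split(1)]] K1 by simp_all
  have 2: "in_Hardy p (\<lambda>z. cnj (wirt_zbar ?w z))" "Hardy_norm p (\<lambda>z. cnj (wirt_zbar ?w z)) \<le> (K - 1) / 2 * L"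
    using in_Hardy_and_norm_le[OF hp holc bound[OF _ _ _ holc split(2)]] K1 by simp_all
  \<comment> \<open>The argument gives the constant (K + 1)/2 for \<open>wirt_z\<close>, which is at
    most K because K \<ge> 1.\<close>
  have "(K + 1) / 2 * L \<le> K * L"
    using K1 Lp_norm_nonneg[OF hLp] by (intro mult_right_mono) (auto simp: L_def)
  then show ?thesis using 1 2 unfolding L_def by auto
qed

end
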